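(* Let $k\ge 2$, let $0=r_0<r_1<\dots<r_k$ be integers, $d=\gcd(r_1,\dots,r_k)$, and let $n$ be a positive integer with $\gcd(n,d)=1$ and $n>N$, where $N$ is the integer associated with $M_n=\langle n,n+r_1,\dots,n+r_k\rangle$ defined in the context. If $M_n$ has a canonical reduction, then $M_{n+\lambda r_k}$ has a canonical reduction for every $\lambda\in\mathbb{N}$.
   Context: $\mathbb{N}$ includes $0$, and $\langle a_1,\dots,a_s\rangle=\{\sum\lambda_i a_i\mid\lambda_i\in\mathbb{N}\}$. For a numerical semigroup $H$ (additive submonoid of $\mathbb{N}$ with finite complement), $\operatorname{F}(H)=\max(\mathbb{Z}\setminus H)$ and $\operatorname{PF}(H)=\{x\in\mathbb{Z}\setminus H\mid x+h\in H\ \forall\, 0\neq h\in H\}$. A one-dimensional Cohen–Macaulay local ring has a canonical reduction if it admits a canonical ideal that is a reduction of its maximal ideal. A numerical semigroup $H$ is said to have a canonical reduction if the semigroup ring $\Bbbk[[H]]$ ($\Bbbk$ a field) does; by a known characterization (Rahimi), for $M_n$ this is equivalent to the condition: $n+\operatorname{F}(M_n)-f\in M_n$ for every $f\in\operatorname{PF}(M_n)$ (here $n$ is the smallest nonzero element of $M_n$). Notation: $S=\langle r_1,\dots,r_k\rangle$; $\operatorname{F}(S)=\max\{s\in\mathbb{Z}\setminus S\mid s\equiv0\bmod d\}$ (possibly negative); $N_0=\max\{r_k^2,r_k^2+\operatorname{F}(S)r_k\}$; for $i\in S$, $\mathbf{m}(i)$ is the minimum of $\lambda_1+\dots+\lambda_k$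 over all expressions $i=\lambda_1r_1+\dots+\lambda_kr_k$ with $\lambda_j\in\mathbb{N}$; $\operatorname{Ap}(S,dn)=\{s\in S\mid s-dn\notin S\}$; for $n>N_0$, $P_n=\{i\in\operatorname{Ap}(S,dn)\mid f\equiv i\bmod n\text{ for some }f\in\operatorname{PF}(M_n)\}$, $P_n'=\{i\in P_n\mid i<dn-r_k\}$, $P_n''=\{i\in P_n\mid i\ge dn-r_k\}$. Definition of $N$ (for $M_n$ with $n>N_0$): $N_1=\max\{0,\ r_k+\ell-i,\ (\mathbf{m}(\ell)-\mathbf{m}(i))r_k-\ell+i \mid i,\ell\in P_n'\}$, $N_2=\max\{0,\ (\mathbf{m}(\ell)-\mathbf{m}(i))r_k-\ell+i\mid i,\ell\in P_n''\}$, $N_3=\max\{0,\ (\mathbf{m}(\ell)r_k+3r_k)/d\mid \ell\in P_n'\}$, $N=\max\{N_0+r_k+\operatorname{F}(S)/d,\ N_1,N_2,N_3\}$. The hypothesis $n>N$ includes $n>N_0$. *)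

theory Defs
  imports
    "HOL-Algebra.Ideal_Product"
    "HOL-Computational_Algebra.Formal_Laurent_Series"
    "HOL-Number_Theory.Cong"
begin

section \<open>Canonical reductions\<close>

text \<open>
  Throughout this section a one-dimensional local domain is given as a subring
  \<open>A\<close> (a set) of a field \<open>Q\<close> (a record), playing the role of its
  field of fractions; the ring itself is \<open>Q\<lparr>carrier := A\<rparr>\<close>.
\<close>

text \<open>Regular fractional ideals. Over a domain, regular means nonzero.\<close>

definition regular_fractional_ideal :: "'q ring \<Rightarrow> 'q set \<Rightarrow> 'q set \<Rightarrow> bool" where
  "regular_fractional_ideal Q A J \<longleftrightarrow>
     subgroup J (add_monoid Q) \<and>
     (\<forall>a\<in>A. \<forall>x\<in>J. a \<otimes>\<^bsub>Q\<^esub> x \<in> J) \<and>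
     (\<exists>a\<in>A - {\<zero>\<^bsub>Q\<^esub>}. \<forall>x\<in>J. a \<otimes>\<^bsub>Q\<^esub> x \<in> A) \<and>
     J \<noteq> {\<zero>\<^bsub>Q\<^esub>}"

definition colon_ideal :: "'q ring \<Rightarrow> 'q set \<Rightarrow> 'q set \<Rightarrow> 'q set" where
  "colon_ideal Q K J = {x \<in> carrier Q. \<forall>y\<in>J. x \<otimes>\<^bsub>Q\<^esub> y \<in> K}"

text \<open>
  Canonical ideals of a one-dimensional Cohen--Macaulay local ring, in the sense of
  Herzog and Kunz (Der kanonische Modul eines Cohen--Macaulay-Rings): \<open>K : (K : J) = J\<close>
  for every regular fractional ideal \<open>J\<close>. Here \<open>K\<close> is moreover
  required to lie in the ring.
\<close>

definition canonical_ideal :: "'q ring \<Rightarrow> 'q set \<Rightarrow> 'q set \<Rightarrow> bool" where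
  "canonical_ideal Q A K \<longleftrightarrow>
     ideal K (Q\<lparr>carrier := A\<rparr>) \<and>
     regular_fractional_ideal Q A K \<and>
     (\<forall>J. regular_fractional_ideal Q A J \<longrightarrow> colon_ideal Q K (colon_ideal Q K J) = J)"

text \<open>Powers of \<open>J\<close> are taken in the monoid of ideals of \<open>R\<close>.\<close>

definition is_reduction :: "'q ring \<Rightarrow> 'q set \<Rightarrow> 'q set \<Rightarrow> bool" where
  "is_reduction R I J \<longleftrightarrow>
     ideal I R \<and> I \<subseteq> J \<and>
     (\<exists>s::nat. ideal_prod R I (J [^]\<^bsub>ideals_set R\<^esub> s) = J [^]\<^bsub>ideals_set R\<^esub> Suc s)"

text \<open>Uniqueness of the maximal ideal says that the ring is local.\<close>

definition ring_has_canonical_reduction :: "'q ring \<Rightarrow> 'q set \<Rightarrow> bool" where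
  "ring_has_canonical_reduction Q A \<longleftrightarrow>
     (\<exists>\<mm> K. {J. maximalideal J (Q\<lparr>carrier := A\<rparr>)} = {\<mm>} \<and>
       canonical_ideal Q A K \<and> is_reduction (Q\<lparr>carrier := A\<rparr>) K \<mm>)"

definition laurent_field :: "'k::field fls ring" where
  "laurent_field = \<lparr>carrier = UNIV, monoid.mult = (*), one = 1, zero = 0, add = (+)\<rparr>"

text \<open>
  For a numerical semigroup \<open>H\<close> this is the ring \<open>k[[H]]\<close>, a subring of
  \<open>k[[t]]\<close> since \<open>H\<close> has no negative elements. Its field of fractions
  is all of \<open>k((t))\<close> since \<open>H\<close> contains all large integers.
\<close>

definition semigroup_ring :: "int set \<Rightarrow> 'k::field fls set" where
  "semigroup_ring H = {x. \<forall>z. fls_nth x z \<noteq> 0 \<longrightarrow> z \<in> H}"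

definition has_canonical_reduction :: "'k::field itself \<Rightarrow> int set \<Rightarrow> bool" where
  "has_canonical_reduction TYPE('k) H \<longleftrightarrow>
     ring_has_canonical_reduction laurent_field (semigroup_ring H :: 'k fls set)"


section \<open>Shifted families of semigroups\<close>

text \<open>Semigroups are regarded as sets of integers, as negative integers occur as gaps.\<close>

definition generated_semigroup :: "(nat \<Rightarrow> int) \<Rightarrow> nat set \<Rightarrow> int set" where
  "generated_semigroup a I = {\<Sum>j\<in>I. int (c j) * a j | c :: nat \<Rightarrow> nat. True}"

definition pseudo_frobenius :: "int set \<Rightarrow> int set" where
  "pseudo_frobenius H = {x. x \<notin> H \<and> (\<forall>h\<in>H. h \<noteq> 0 \<longrightarrow> x + h \<in> H)}"

text \<open>
  In what follows, \<open>r 1, \<dots>, r k\<close> are the given integers. In \<open>M\<close> the index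
  \<open>0\<close> with \<open>r 0 = 0\<close> contributes the generator \<open>n\<close>.
\<close>

definition M :: "nat \<Rightarrow> (nat \<Rightarrow> nat) \<Rightarrow> nat \<Rightarrow> int set" where
  "M k r n = generated_semigroup (\<lambda>j. int n + int (r j)) {0..k}"

definition S :: "nat \<Rightarrow> (nat \<Rightarrow> nat) \<Rightarrow> int set" where
  "S k r = generated_semigroup (\<lambda>j. int (r j)) {1..k}"

definition d :: "nat \<Rightarrow> (nat \<Rightarrow> nat) \<Rightarrow> nat" where
  "d k r = Gcd (r ` {1..k})"

definition F_S :: "nat \<Rightarrow> (nat \<Rightarrow> nat) \<Rightarrow> int" where
  "F_S k r = (GREATEST s. s \<notin> S k r \<and> [s = 0] (mod int (d k r)))"

definition N0 :: "nat \<Rightarrow> (nat \<Rightarrow> nat) \<Rightarrow> int" where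
  "N0 k r = max ((int (r k))\<^sup>2) ((int (r k))\<^sup>2 + F_S k r * int (r k))"

text \<open>The minimal length of an expression of \<open>i \<in> S k r\<close> in the generators.\<close>

definition min_length :: "nat \<Rightarrow> (nat \<Rightarrow> nat) \<Rightarrow> int \<Rightarrow> nat" where
  "min_length k r i =
     (LEAST l. \<exists>c :: nat \<Rightarrow> nat. i = (\<Sum>j\<in>{1..k}. int (c j) * int (r j)) \<and> l = (\<Sum>j\<in>{1..k}. c j))"

definition Apery :: "int set \<Rightarrow> int \<Rightarrow> int set" where
  "Apery H m = {s \<in> H. s - m \<notin> H}"

definition P :: "nat \<Rightarrow> (nat \<Rightarrow> nat) \<Rightarrow> nat \<Rightarrow> int set" where
  "P k r n = {i \<in> Apery (S k r) (int (d k r) * int n).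
                \<exists>f \<in> pseudo_frobenius (M k r n). [f = i] (mod int n)}"

definition P' :: "nat \<Rightarrow> (nat \<Rightarrow> nat) \<Rightarrow> nat \<Rightarrow> int set" where
  "P' k r n = {i \<in> P k r n. i < int (d k r) * int n - int (r k)}"

definition P'' :: "nat \<Rightarrow> (nat \<Rightarrow> nat) \<Rightarrow> nat \<Rightarrow> int set" where
  "P'' k r n = {i \<in> P k r n. i \<ge> int (d k r) * int n - int (r k)}"

definition N1 :: "nat \<Rightarrow> (nat \<Rightarrow> nat) \<Rightarrow> nat \<Rightarrow> int" where
  "N1 k r n = Max ({0}
     \<union> {int (r k) + l - i | i l. i \<in> P' k r n \<and> l \<in> P' k r n}
     \<union> {(int (min_length k r l) - int (min_length k r i)) * int (r k) - l + i
          | i l. i \<in> P' k r n \<and> l \<in> P' k r n})"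

definition N2 :: "nat \<Rightarrow> (nat \<Rightarrow> nat) \<Rightarrow> nat \<Rightarrow> int" where
  "N2 k r n = Max ({0}
     \<union> {(int (min_length k r l) - int (min_length k r i)) * int (r k) - l + i
          | i l. i \<in> P'' k r n \<and> l \<in> P'' k r n})"

text \<open>
  The integer divisions in \<open>N3\<close> and \<open>N_bound\<close> are exact: \<open>d k r\<close>
  divides both \<open>r k\<close> and \<open>F_S k r\<close>.
\<close>

definition N3 :: "nat \<Rightarrow> (nat \<Rightarrow> nat) \<Rightarrow> nat \<Rightarrow> int" where
  "N3 k r n = Max ({0}
     \<union> {(int (min_length k r l) * int (r k) + 3 * int (r k)) div int (d k r) | l. l \<in> P' k r n})"

definition N_bound :: "nat \<Rightarrow> (nat \<Rightarrow> nat) \<Rightarrow> nat \<Rightarrow> int" where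
  "N_bound k r n =
     Max {N0 k r + int (r k) + F_S k r div int (d k r), N1 k r n, N2 k r n, N3 k r n}"

end

theory Submission
  imports Defs
begin

text \<open>
  The proof has two independent halves.

  The algebraic half turns the existence of a canonical reduction into arithmetic
  (\<open>has_canonical_reduction_iff\<close>): for a numerical semigroup \<open>H\<close> with Frobenius number
  \<open>F\<close> and multiplicity \<open>e\<close>, the ring \<open>R = k[[H]]\<close> has a canonical reduction iff
  \<open>e + F - f \<in> H\<close> for all pseudo-Frobenius numbers \<open>f\<close>. Let \<open>K\<close> be the set of
  series with exponents in \<open>{x. F - x \<notin> H}\<close>. For the bilinear form
  \<open>(x, y) \<mapsto> coefficient of t^F in x * y\<close> on \<open>k((t))\<close>, the colon \<open>K : J\<close> is the
  orthogonal complement of \<open>J\<close>, and linear algebra gives \<open>K : (K : J) = J\<close>; so \<open>K\<close> is a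
  canonical fractional ideal. Two canonical fractional ideals of a local ring differ by a factor, so
  every canonical ideal has the form \<open>c K\<close>. If it is a reduction of the maximal ideal,
  comparing orders shows that \<open>c\<close> has order \<open>e\<close>, and then \<open>c K \<subseteq> R\<close> says
  that the exponents \<open>e + (F - f)\<close> lie in \<open>H\<close>. Conversely these conditions put
  \<open>t^e K\<close> into \<open>R\<close>, and it contains \<open>t^e\<close>, which already generates a reduction.

  The arithmetic half describes \<open>M_n\<close>. An integer \<open>L n + i\<close> with \<open>i\<close> in the Apery set
  of \<open>S\<close> with respect to \<open>d n\<close> lies in \<open>M_n\<close> iff \<open>L\<close> is at least the minimal
  length \<open>m(i)\<close> (\<open>mem_M_Ap_iff\<close>). This rests on the estimate
  \<open>i \<le> r_k m(i) \<le> i + r_k^2\<close> and on \<open>m(i + r_k) = m(i) + 1\<close> for large \<open>i\<close>;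
  both come from the fact that a shortest expression contains fewer than \<open>r_k\<close> generators other
  than \<open>r_k\<close>. Consequently the set \<open>P'_n\<close> of small indices of pseudo-Frobenius numbers does
  not change when \<open>n\<close> grows by \<open>t r_k\<close>, while the set \<open>P''_n\<close> of large indices moves
  by \<open>t d r_k\<close> and the lengths there grow by \<open>t d\<close>. The Frobenius number comes from an index
  \<open>l \<in> P''_n\<close>. The condition for the index \<open>i\<close> reads
  \<open>(1 + m(l) - m(i)) n + (l - i) \<in> M_n\<close>, which means that some
  \<open>s = l - i + q d n \<in> S\<close> satisfies \<open>m(s) \<le> 1 + m(l) - m(i) - q d\<close>. The bounds
  on \<open>n\<close> force \<open>q \<le> 0\<close>, and for such \<open>q\<close> the same \<open>q\<close> works after
  the shift (\<open>canonical_reduction_shift\<close>).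
\<close>

section \<open>Laurent series and linear functionals\<close>

unbundle fps_syntax

lemma fls_nth_mult_nonzeroD:
  fixes x y :: "'k::field fls"
  assumes "(x * y) $$ n \<noteq> 0"
  shows "\<exists>i. x $$ i \<noteq> 0 \<and> y $$ (n - i) \<noteq> 0"
proof (rule ccontr)
  assume "\<not> ?thesis"
  then have "x $$ i * y $$ (n - i) = 0" for i by auto
  then have "(x * y) $$ n = 0" unfolding fls_times_nth(2) by (intro sum.neutral ballI)
  with assms show False by simp
qed

lemma fls_nth_monom_mult [simp]:
  fixes x :: "'k::field fls"
  shows "(fls_shift m 1 * x) $$ z = x $$ (z + m)" "(x * fls_shift m 1) $$ z = x $$ (z + m)"
  using fls_X_intpow_times_conv_shift[where i = "-m" and f = x] by simp_all

lemma fls_nth_const_mult [simp]: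
  fixes x :: "'k::field fls"
  shows "(fls_const c * x) $$ z = c * x $$ z"
  by (cases "z < fls_subdegree x") (simp_all add: fls_times_nth(2)[of "fls_const c" x z] sum.delta if_distrib
      cong: if_cong)

text \<open>
  Splitting off finitely many monomials reduces statements about all series to monomials and to series
  of high order.
\<close>

lemma fls_truncate:
  fixes x :: "'k::field fls"
  obtains y I where "finite I" "\<And>i. i \<in> I \<Longrightarrow> x $$ i \<noteq> 0"
    "x = (\<Sum>i\<in>I. fls_const (x $$ i) * fls_X_intpow i) + y"
    "\<And>z. y $$ z = (if z < b then 0 else x $$ z)"
proof -
  define I where "I = {i \<in> {fls_subdegree x..<b}. x $$ i \<noteq> 0}"
  define y where "y = x - (\<Sum>i\<in>I. fls_const (x $$ i) * fls_X_intpow i)"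
  have fin: "finite I" unfolding I_def by (rule finite_subset[of _ "{fls_subdegree x..<b}"]) auto
  have "(\<Sum>i\<in>I. fls_const (x $$ i) * fls_X_intpow i) $$ z = (if z < b then x $$ z else 0)" for z
  proof -
    have "(\<Sum>i\<in>I. fls_const (x $$ i) * fls_X_intpow i) $$ z = (\<Sum>i\<in>I. if i = z then x $$ i else 0)"
      unfolding fls_nth_sum by (rule sum.cong) auto
    also have "\<dots> = (if z \<in> I then x $$ z else 0)" using fin by simp
    also have "\<dots> = (if z < b then x $$ z else 0)"
      unfolding I_def using fls_subdegree_leI[of x z] by auto
    finally show ?thesis .
  qed
  then have y: "y $$ z = (if z < b then 0 else x $$ z)" for z unfolding y_def by simp
  show ?thesis
  proof (rule that[OF fin _ _ y])
    show "x $$ i \<noteq> 0" if "i \<in> I" for i using that by (simp add: I_def)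
    show "x = (\<Sum>i\<in>I. fls_const (x $$ i) * fls_X_intpow i) + y" by (simp add: y_def)
  qed
qed

text \<open>
  A functional that vanishes on all series of order at least \<open>b\<close> is determined by its values on
  monomials. These values, read backwards from \<open>F\<close>, are the coefficients of \<open>y\<close>; they
  form a Laurent series because \<open>t^i\<close> is killed for \<open>i \<ge> b\<close>.
\<close>

lemma coefficient_functional:
  fixes \<phi> :: "'k::field fls \<Rightarrow> 'k"
  assumes add: "\<And>x y. \<phi> (x + y) = \<phi> x + \<phi> y"
    and scale: "\<And>c x. \<phi> (fls_const c * x) = c * \<phi> x"
    and tail: "\<And>x. (\<And>z. z < b \<Longrightarrow> x $$ z = 0) \<Longrightarrow> \<phi> x = 0"
  shows "\<exists>y. \<forall>x. (y * x) $$ F = \<phi> x"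
proof -
  define y where "y = Abs_fls (\<lambda>z. \<phi> (fls_X_intpow (F - z)))"
  have y: "y $$ z = \<phi> (fls_X_intpow (F - z))" for z
    unfolding y_def
  proof (rule nth_Abs_fls_lower_bound[of "F - b + 1"], intro allI impI)
    fix z assume "z < F - b + 1"
    then show "\<phi> (fls_X_intpow (F - z)) = 0" by (intro tail) auto
  qed
  have y0: "y $$ z = 0" if "z \<le> F - b" for z
    unfolding y by (rule tail) (use that in auto)
  have zero: "\<phi> 0 = 0" using scale[of 0 0] by simp
  have sum: "\<phi> (sum f I) = (\<Sum>i\<in>I. \<phi> (f i))" if "finite I" for f and I :: "int set"
    using that by (induction I) (auto simp: add zero)
  have "(y * x) $$ F = \<phi> x" for x
  proof -
    obtain I t where I: "finite I" and x: "x = (\<Sum>i\<in>I. fls_const (x $$ i) * fls_X_intpow i) + t"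
      and t: "\<And>z. t $$ z = (if z < b then 0 else x $$ z)"
      by (rule fls_truncate[of x b]) blast
    have "(y * t) $$ F = 0"
    proof (rule ccontr)
      assume "(y * t) $$ F \<noteq> 0"
      then obtain i where "y $$ i \<noteq> 0" "t $$ (F - i) \<noteq> 0" using fls_nth_mult_nonzeroD by blast
      then have "\<not> i \<le> F - b" "\<not> F - i < b" using y0 t by auto
      then show False by linarith
    qed
    moreover have "(y * (\<Sum>i\<in>I. fls_const (x $$ i) * fls_X_intpow i)) $$ F
        = (\<Sum>i\<in>I. x $$ i * \<phi> (fls_X_intpow i))"
      unfolding sum_distrib_left fls_nth_sum
      by (rule sum.cong) (simp_all add: mult.left_commute[of y] y)
    ultimately have "(y * x) $$ F = (\<Sum>i\<in>I. x $$ i * \<phi> (fls_X_intpow i))"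
      by (subst x) (simp add: distrib_left)
    also have "\<dots> = \<phi> x" by (subst (2) x) (simp add: add sum[OF I] scale tail t)
    finally show ?thesis .
  qed
  then show ?thesis by blast
qed

text \<open>
  A basis of \<open>J\<close> stays independent when \<open>w\<close> is added, so values on it may be prescribed.
\<close>

lemma separating_functional:
  fixes J :: "'k::field fls set"
  assumes J0: "0 \<in> J" and Jadd: "\<And>x y. x \<in> J \<Longrightarrow> y \<in> J \<Longrightarrow> x + y \<in> J"
    and Jscale: "\<And>c x. x \<in> J \<Longrightarrow> fls_const c * x \<in> J"
    and w: "w \<notin> J"
  obtains \<phi> where "\<And>x y. \<phi> (x + y) = \<phi> x + \<phi> y" "\<And>c x. \<phi> (fls_const c * x) = c * \<phi> x"
    "\<And>x. x \<in> J \<Longrightarrow> \<phi> x = 0" "\<phi> w = (1::'k)"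
proof -
  interpret vector_space "\<lambda>c x :: 'k fls. fls_const c * x"
    by unfold_locales (auto simp: algebra_simps fls_plus_const[symmetric] simp flip: fls_const_mult_const)
  interpret pair: vector_space_pair "\<lambda>c x :: 'k fls. fls_const c * x" "\<lambda>c x :: 'k. c * x"
    by unfold_locales (auto simp: algebra_simps)
  have sub: "subspace J" unfolding subspace_def using J0 Jadd Jscale by auto
  obtain B where B: "B \<subseteq> J" "independent B" "J \<subseteq> span B"
    by (rule maximal_independent_subset)
  have spanB: "span B = J" using B span_minimal[OF B(1) sub] by auto
  have "independent (insert w B)" using B w spanB by (intro independent_insertI) auto
  then obtain g where g: "Vector_Spaces.linear (\<lambda>c x :: 'k fls. fls_const c * x) (*) g"
     "\<forall>x\<in>insert w B. g x = (if x = w then 1 else 0)"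
    using pair.linear_independent_extend[of "insert w B" "\<lambda>x. if x = w then 1 else 0"] by blast
  interpret g: Vector_Spaces.linear "\<lambda>c x :: 'k fls. fls_const c * x" "(*)" g by (rule g(1))
  show ?thesis
  proof (rule that[of g])
    fix x assume "x \<in> J"
    then have "x \<in> span B" using spanB by simp
    moreover have "\<And>x. x \<in> B \<Longrightarrow> g x = 0" using g(2) B(1) w by auto
    ultimately show "g x = 0" by (metis g.eq_0_on_span)
  qed (use g g.add g.scale in auto)
qed

section \<open>Series with exponents in a given set\<close>

text \<open>
  The set \<open>A\<close> of exponents is arbitrary here: besides the ring itself, its monomial ideals and
  the canonical module are of the form \<open>semigroup_ring A\<close>.
\<close>

lemma semigroup_ring_add: "x \<in> semigroup_ring A \<Longrightarrow> y \<in> semigroup_ring A \<Longrightarrow> x + y \<in> semigroup_ring A"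
  unfolding semigroup_ring_def by (auto, metis add_0)

lemma semigroup_ring_uminus: "x \<in> semigroup_ring A \<Longrightarrow> - x \<in> semigroup_ring A"
  unfolding semigroup_ring_def by auto

lemma semigroup_ring_zero: "0 \<in> semigroup_ring A"
  unfolding semigroup_ring_def by auto

lemma semigroup_ring_monom: "i \<in> A \<Longrightarrow> fls_X_intpow i \<in> semigroup_ring A"
  unfolding semigroup_ring_def by (auto split: if_splits)

lemma semigroup_ring_const: "0 \<in> A \<Longrightarrow> fls_const c \<in> semigroup_ring A"
  unfolding semigroup_ring_def by (auto split: if_splits)

lemma semigroup_ring_one: "0 \<in> A \<Longrightarrow> 1 \<in> semigroup_ring A"
  using semigroup_ring_const[of A 1] by simp

lemma semigroup_ring_mono: "A \<subseteq> B \<Longrightarrow> semigroup_ring A \<subseteq> semigroup_ring B"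
  unfolding semigroup_ring_def by auto

lemma semigroup_ring_mult:
  assumes "x \<in> semigroup_ring A" "y \<in> semigroup_ring B" "\<And>a b. a \<in> A \<Longrightarrow> b \<in> B \<Longrightarrow> a + b \<in> C"
  shows "x * y \<in> semigroup_ring C"
  unfolding semigroup_ring_def
proof (clarify)
  fix z assume "(x * y) $$ z \<noteq> 0"
  then obtain i where "x $$ i \<noteq> 0" "y $$ (z - i) \<noteq> 0" using fls_nth_mult_nonzeroD by blast
  then have "i + (z - i) \<in> C" using assms(1,2) by (intro assms(3)) (simp_all add: semigroup_ring_def)
  then show "z \<in> C" by simp
qed

lemma semigroup_ring_translate:
  "semigroup_ring {z. z - e \<in> A} = (\<lambda>x. fls_X_intpow e * x) ` semigroup_ring A" (is "?L = ?R")
proof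
  show "?R \<subseteq> ?L" unfolding semigroup_ring_def by auto
  show "?L \<subseteq> ?R"
  proof
    fix x :: "'a fls" assume x: "x \<in> ?L"
    have "fls_X_intpow (-e) * x \<in> semigroup_ring A"
      unfolding semigroup_ring_def using x by (auto simp: semigroup_ring_def)
    moreover have "x = fls_X_intpow e * (fls_X_intpow (-e) * x)" by (rule fls_eqI) simp
    ultimately show "x \<in> ?R" by blast
  qed
qed


section \<open>Colon ideals and scaling\<close>

lemma laurent_field_simps [simp]:
  "carrier laurent_field = UNIV" "monoid.mult laurent_field = (*)" "one laurent_field = 1"
  "zero laurent_field = 0" "add laurent_field = (+)"
  by (simp_all add: laurent_field_def)

lemma colon_ideal_laurent: "colon_ideal laurent_field K J = {x. \<forall>y\<in>J. x * y \<in> K}"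
  by (simp add: colon_ideal_def)

lemma mem_colon_ideal_image_iff:
  fixes c :: "'k::field fls"
  assumes "c \<noteq> 0"
  shows "c * x \<in> colon_ideal laurent_field ((\<lambda>x. c * x) ` K) J \<longleftrightarrow> x \<in> colon_ideal laurent_field K J"
  using assms by (auto simp: colon_ideal_laurent mult.assoc image_iff)

text \<open>
  The two factors cancel, as \<open>cK : J = c (K : J)\<close> and \<open>cK : cJ' = K : J'\<close>. Hence all
  nonzero multiples of \<open>K\<close> have the same double colon ideals.
\<close>

lemma double_colon_ideal_image:
  fixes c :: "'k::field fls"
  assumes "c \<noteq> 0"
  shows "colon_ideal laurent_field ((\<lambda>x. c * x) ` K) (colon_ideal laurent_field ((\<lambda>x. c * x) ` K) J)
    = colon_ideal laurent_field K (colon_ideal laurent_field K J)"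
proof -
  have "colon_ideal laurent_field ((\<lambda>x. c * x) ` K) J = (\<lambda>x. c * x) ` colon_ideal laurent_field K J"
  proof (rule Set.set_eqI)
    fix x
    have x: "x = c * (x / c)" using assms by simp
    have "x \<in> colon_ideal laurent_field ((\<lambda>x. c * x) ` K) J \<longleftrightarrow> x / c \<in> colon_ideal laurent_field K J"
      using mem_colon_ideal_image_iff[OF assms, of "x / c"] assms by simp
    also have "\<dots> \<longleftrightarrow> x \<in> (\<lambda>x. c * x) ` colon_ideal laurent_field K J"
    proof
      assume "x / c \<in> colon_ideal laurent_field K J"
      then show "x \<in> (\<lambda>x. c * x) ` colon_ideal laurent_field K J" by (intro image_eqI[where x = "x / c"]) (simp_all add: assms)
    qed (use assms in auto)
    finally show "x \<in> colon_ideal laurent_field ((\<lambda>x. c * x) ` K) J \<longleftrightarrow> x \<in> (\<lambda>x. c * x) ` colon_ideal laurent_field K J" .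
  qed
  moreover have "colon_ideal laurent_field ((\<lambda>x. c * x) ` K) ((\<lambda>x. c * x) ` J') = colon_ideal laurent_field K J'" for J'
    using assms by (auto simp: colon_ideal_laurent mult.left_commute image_iff)
  ultimately show ?thesis by simp
qed

section \<open>The canonical module of a numerical semigroup ring\<close>

text \<open>\<open>F\<close> is the Frobenius number and \<open>e\<close> the multiplicity of \<open>H\<close>.\<close>

locale numerical_semigroup =
  fixes H :: "int set" and F e :: int
  assumes zero_mem: "0 \<in> H"
    and add_mem: "a \<in> H \<Longrightarrow> b \<in> H \<Longrightarrow> a + b \<in> H"
    and nonneg: "a \<in> H \<Longrightarrow> 0 \<le> a"
    and frobenius_not_mem: "F \<notin> H"
    and above_frobenius: "F < z \<Longrightarrow> z \<in> H"
    and multiplicity_mem: "e \<in> H"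
    and multiplicity_pos: "0 < e"
    and multiplicity_le: "a \<in> H \<Longrightarrow> a \<noteq> 0 \<Longrightarrow> e \<le> a"
begin
unbundle fps_syntax

abbreviation R :: "'k::field fls ring" where
  "R \<equiv> laurent_field\<lparr>carrier := semigroup_ring H\<rparr>"

text \<open>
  The exponents of the standard canonical module: the complement of the reflection of \<open>H\<close> at
  \<open>F\<close>.
\<close>

abbreviation KH :: "int set" where
  "KH \<equiv> {x. F - x \<notin> H}"

lemma KH_nonneg: "x \<in> KH \<Longrightarrow> 0 \<le> x"
  using above_frobenius[of "F - x"] by fastforce

lemma zero_KH: "0 \<in> KH" using frobenius_not_mem by simp

lemma KH_add: "h \<in> H \<Longrightarrow> x \<in> KH \<Longrightarrow> h + x \<in> KH"
  using add_mem[of h "F - (h + x)"] by auto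

lemma semigroup_ring_mult_closed:
  "x \<in> semigroup_ring H \<Longrightarrow> y \<in> semigroup_ring H \<Longrightarrow> x * y \<in> semigroup_ring H"
  by (rule semigroup_ring_mult) (auto intro: add_mem)

lemma cring_R: "cring (R :: 'k::field fls ring)"
proof (intro cringI abelian_groupI comm_monoidI)
  fix x :: "'k fls" assume "x \<in> carrier R"
  then show "\<exists>y\<in>carrier R. y \<oplus>\<^bsub>R\<^esub> x = \<zero>\<^bsub>R\<^esub>"
    by (intro bexI[of _ "-x"]) (auto simp: semigroup_ring_uminus)
qed (auto simp: semigroup_ring_add semigroup_ring_zero semigroup_ring_mult_closed
    semigroup_ring_one zero_mem algebra_simps)

text \<open>
  Closure under multiplication by the ring gives additive inverses, since \<open>-1\<close> is in the ring.
\<close>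

lemma subgroup_laurent_iff:
  fixes I A :: "'k::field fls set"
  assumes "semigroup_ring H \<subseteq> A"
  shows "subgroup I (add_monoid (laurent_field\<lparr>carrier := A\<rparr>)) \<and> (\<forall>a\<in>semigroup_ring H. \<forall>x\<in>I. a * x \<in> I) \<longleftrightarrow>
    I \<subseteq> A \<and> 0 \<in> I \<and> (\<forall>x\<in>I. \<forall>y\<in>I. x + y \<in> I) \<and> (\<forall>a\<in>semigroup_ring H. \<forall>x\<in>I. a * x \<in> I)"
    (is "?l \<longleftrightarrow> ?r")
proof
  assume l: ?l
  then have s: "subgroup I (add_monoid (laurent_field\<lparr>carrier := A\<rparr>))" by blast
  show ?r using l subgroup.subset[OF s] subgroup.one_closed[OF s] subgroup.m_closed[OF s] by simp
next
  assume r: ?r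
  have "inv\<^bsub>add_monoid (laurent_field\<lparr>carrier := A\<rparr>)\<^esub> x \<in> I" if "x \<in> I" for x
  proof -
    have m: "- x \<in> I" using r that semigroup_ring_uminus[OF semigroup_ring_one[OF zero_mem]]
      by (metis mult_minus1)
    have "inv\<^bsub>add_monoid (laurent_field\<lparr>carrier := A\<rparr>)\<^esub> x = - x"
      unfolding m_inv_def
      by (rule the_equality) (use m r that in \<open>auto simp: eq_neg_iff_add_eq_0\<close>)
    with m show ?thesis by simp
  qed
  then show ?l using r by (auto intro!: subgroup.intro)
qed

lemma ideal_R_iff:
  "ideal I (R :: 'k::field fls ring) \<longleftrightarrow>
    I \<subseteq> semigroup_ring H \<and> 0 \<in> I \<and> (\<forall>x\<in>I. \<forall>y\<in>I. x + y \<in> I) \<and> (\<forall>a\<in>semigroup_ring H. \<forall>x\<in>I. a * x \<in> I)"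
    (is "?l \<longleftrightarrow> ?r")
proof
  assume l: ?l
  interpret ideal I R by (rule l)
  have "subgroup I (add_monoid R)" by (rule a_subgroup)
  moreover have "\<forall>a\<in>semigroup_ring H. \<forall>x\<in>I. a * x \<in> I" using I_l_closed by simp
  ultimately show ?r using subgroup_laurent_iff[of "semigroup_ring H" I] by simp
next
  assume r: ?r
  then have "subgroup I (add_monoid R)" using subgroup_laurent_iff[of "semigroup_ring H" I] by simp
  moreover have "ring (R :: 'k fls ring)" by (rule cring.axioms(1)[OF cring_R])
  moreover have "x * a \<in> I" "a * x \<in> I" if "a \<in> I" "x \<in> semigroup_ring H" for a x
    using r that by (auto simp: mult.commute[of a x])
  ultimately show ?l by (intro idealI) simp_all
qed

lemma regular_fractional_ideal_iff:
  "regular_fractional_ideal laurent_field (semigroup_ring H) (J :: 'k::field fls set) \<longleftrightarrow>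
    0 \<in> J \<and> (\<forall>x\<in>J. \<forall>y\<in>J. x + y \<in> J) \<and> (\<forall>a\<in>semigroup_ring H. \<forall>x\<in>J. a * x \<in> J) \<and>
    (\<exists>a\<in>semigroup_ring H - {0}. \<forall>x\<in>J. a * x \<in> semigroup_ring H) \<and> J \<noteq> {0}"
proof -
  have *: "laurent_field\<lparr>carrier := UNIV\<rparr> = (laurent_field :: 'k fls ring)" by (simp add: laurent_field_def)
  show ?thesis unfolding regular_fractional_ideal_def
    using subgroup_laurent_iff[of UNIV J] unfolding * by auto
qed

lemma mem_K_nth_frobenius: "x \<in> semigroup_ring KH \<Longrightarrow> x $$ F = 0"
  using zero_mem by (auto simp: semigroup_ring_def)

text \<open>
  The exponent \<open>F\<close> is missing in \<open>K\<close>, as \<open>0 \<in> H\<close>. Conversely, an exponent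
  \<open>z\<close> with \<open>F - z \<in> H\<close> is moved to \<open>F\<close> by an element of the ring. So membership
  in \<open>K\<close> is detected by the coefficient at \<open>F\<close> alone, and \<open>K : J\<close> is the
  orthogonal complement of \<open>J\<close>.
\<close>

lemma mem_K_iff:
  "x \<in> semigroup_ring KH \<longleftrightarrow> (\<forall>a\<in>semigroup_ring H. (a * x) $$ F = (0::'k::field))"
proof
  assume "x \<in> semigroup_ring KH"
  then show "\<forall>a\<in>semigroup_ring H. (a * x) $$ F = 0"
    by (intro ballI mem_K_nth_frobenius semigroup_ring_mult) (use KH_add in auto)
next
  assume r: "\<forall>a\<in>semigroup_ring H. (a * x) $$ F = 0"
  show "x \<in> semigroup_ring KH" unfolding semigroup_ring_def
  proof clarify
    fix z assume "x $$ z \<noteq> 0" "F - z \<in> H"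
    then show False using r semigroup_ring_monom[of "F - z" H] by fastforce
  qed
qed

lemma mem_colon_K_iff:
  assumes "\<forall>a\<in>semigroup_ring H. \<forall>x\<in>J. a * x \<in> J"
  shows "y \<in> colon_ideal laurent_field (semigroup_ring KH) J \<longleftrightarrow> (\<forall>x\<in>J. (y * x) $$ F = (0::'k::field))"
proof
  assume "y \<in> colon_ideal laurent_field (semigroup_ring KH) J"
  then show "\<forall>x\<in>J. (y * x) $$ F = 0" using mem_K_nth_frobenius by (auto simp: colon_ideal_laurent)
next
  assume r: "\<forall>x\<in>J. (y * x) $$ F = 0"
  have "(a * (y * x)) $$ F = 0" if "x \<in> J" "a \<in> semigroup_ring H" for x a
    using r assms that by (metis mult.left_commute)
  then show "y \<in> colon_ideal laurent_field (semigroup_ring KH) J"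
    unfolding colon_ideal_laurent mem_K_iff by auto
qed

text \<open>
  The ring contains every series of order greater than \<open>F\<close>, so the multiples of a nonzero
  \<open>x \<in> J\<close> already include every series of high order.
\<close>

lemma tail_mem:
  assumes "\<forall>a\<in>semigroup_ring H. \<forall>x\<in>J. a * x \<in> J" "x \<in> J" "x \<noteq> (0::'k::field fls)"
    and "\<And>z. z \<le> F + fls_subdegree x \<Longrightarrow> y $$ z = 0"
  shows "y \<in> J"
proof -
  have "y / x \<in> semigroup_ring H"
  proof (cases "y = 0")
    case False
    then have yx: "y / x \<noteq> 0" using assms by simp
    have "F + fls_subdegree x + 1 \<le> fls_subdegree y"
      using False assms(4) by (intro fls_subdegree_geI) auto
    moreover have "fls_subdegree y = fls_subdegree (y / x * x)" using assms by simp
    then have "fls_subdegree y = fls_subdegree (y / x) + fls_subdegree x"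
      using yx assms by (subst (asm) fls_subdegree_mult) auto
    ultimately have "F < fls_subdegree (y / x)" by linarith
    then show ?thesis unfolding semigroup_ring_def
      by (auto intro!: above_frobenius) (meson dual_order.strict_trans1 fls_eq0_below_subdegree not_le)
  qed (simp add: semigroup_ring_zero)
  then have "y / x * x \<in> J" using assms by blast
  then show ?thesis using assms by simp
qed

text \<open>
  If \<open>w \<notin> J\<close>, a linear functional vanishes on \<open>J\<close> but not at \<open>w\<close>. It vanishes
  on all series of high order, so it is the pairing with some series \<open>y\<close>. Then \<open>y\<close> lies in
  \<open>K : J\<close> but is not orthogonal to \<open>w\<close>.
\<close>

theorem colon_K_colon_K:
  fixes J :: "'k::field fls set"
  assumes J0: "0 \<in> J" "\<forall>x\<in>J. \<forall>y\<in>J. x + y \<in> J"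
    and Jmult: "\<forall>a\<in>semigroup_ring H. \<forall>x\<in>J. a * x \<in> J" and nz: "J \<noteq> {0}"
  shows "colon_ideal laurent_field (semigroup_ring KH) (colon_ideal laurent_field (semigroup_ring KH) J) = J"
    (is "?C (?C J) = J")
proof
  show "J \<subseteq> ?C (?C J)" by (auto simp: colon_ideal_laurent mult.commute)
  show "?C (?C J) \<subseteq> J"
  proof (rule subsetI, rule ccontr)
    fix w assume w: "w \<in> ?C (?C J)" "w \<notin> J"
    obtain x0 where x0: "x0 \<in> J" "x0 \<noteq> 0" using nz J0 by auto
    obtain \<phi> where phi: "\<And>x y. \<phi> (x + y) = \<phi> x + \<phi> y" "\<And>c x. \<phi> (fls_const c * x) = c * \<phi> x"
      "\<And>x. x \<in> J \<Longrightarrow> \<phi> x = 0" "\<phi> w = 1"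
    proof (rule separating_functional[of J w])
      show "fls_const c * x \<in> J" if "x \<in> J" for c x
        using Jmult semigroup_ring_const[OF zero_mem, of c] that by blast
    qed (use J0 w in auto)
    obtain y where y: "\<forall>x. (y * x) $$ F = \<phi> x"
      using coefficient_functional[of \<phi> "F + fls_subdegree x0 + 1" F] phi tail_mem[OF Jmult x0] by auto
    have "y \<in> ?C J" unfolding mem_colon_K_iff[OF Jmult] using y phi by auto
    then have "w * y \<in> semigroup_ring KH" using w by (auto simp: colon_ideal_laurent)
    then have "(w * y) $$ F = 0" by (rule mem_K_nth_frobenius)
    then show False using y phi by (simp add: mult.commute)
  qed
qed


lemma K_mult_closed:
  "a \<in> semigroup_ring H \<Longrightarrow> x \<in> semigroup_ring KH \<Longrightarrow> a * x \<in> semigroup_ring KH"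
  by (rule semigroup_ring_mult) (use KH_add in auto)

lemma one_mem_K: "1 \<in> semigroup_ring KH"
  using zero_KH by (intro semigroup_ring_one)

text \<open>This is double duality for the ring itself, because \<open>K : R = K\<close>.\<close>

lemma colon_K_K: "colon_ideal laurent_field (semigroup_ring KH) (semigroup_ring KH :: 'k::field fls set)
    = semigroup_ring H"
proof -
  have one: "(1 :: 'k fls) \<in> semigroup_ring H" using zero_mem by (rule semigroup_ring_one)
  have "colon_ideal laurent_field (semigroup_ring KH) (semigroup_ring H :: 'k fls set) = semigroup_ring KH"
  proof
    show "colon_ideal laurent_field (semigroup_ring KH) (semigroup_ring H :: 'k fls set) \<subseteq> semigroup_ring KH"
      using one unfolding colon_ideal_laurent by force
    show "(semigroup_ring KH :: 'k fls set) \<subseteq> colon_ideal laurent_field (semigroup_ring KH) (semigroup_ring H)"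
      by (auto simp: colon_ideal_laurent) (metis K_mult_closed mult.commute)
  qed
  moreover have "colon_ideal laurent_field (semigroup_ring KH)
     (colon_ideal laurent_field (semigroup_ring KH) (semigroup_ring H :: 'k fls set)) = semigroup_ring H"
    by (rule colon_K_colon_K)
      (use one semigroup_ring_zero semigroup_ring_add semigroup_ring_mult_closed in force)+
  ultimately show ?thesis by simp
qed

lemma regular_fractional_ideal_K:
  "regular_fractional_ideal laurent_field (semigroup_ring H) (semigroup_ring KH :: 'k::field fls set)"
proof -
  have "fls_X_intpow (F + 1) * x \<in> semigroup_ring H" if "x \<in> semigroup_ring KH" for x :: "'k fls"
    by (rule semigroup_ring_mult[OF semigroup_ring_monom[of _ "{F + 1}"] that])
      (use KH_nonneg in \<open>force intro!: above_frobenius\<close>)+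
  moreover have "fls_X_intpow (F + 1) \<in> semigroup_ring H - {0 :: 'k fls}"
    using semigroup_ring_monom[of "F + 1" H] above_frobenius[of "F + 1"]
    by (simp add: fls_shift_eq0_iff)
  ultimately have "\<exists>a\<in>semigroup_ring H - {0 :: 'k fls}. \<forall>x\<in>semigroup_ring KH. a * x \<in> semigroup_ring H"
    by blast
  moreover have "semigroup_ring KH \<noteq> {0 :: 'k fls}" using one_mem_K one_neq_zero by blast
  ultimately show ?thesis
    unfolding regular_fractional_ideal_iff by (simp add: semigroup_ring_zero semigroup_ring_add K_mult_closed)
qed

lemma add_mem_nonzero: "h \<in> H \<Longrightarrow> b \<in> H - {0} \<Longrightarrow> h + b \<in> H - {0}"
  using add_mem[of h b] nonneg[of h] nonneg[of b] by auto

section \<open>The maximal ideal and its powers\<close>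

abbreviation \<mm> :: "'k::field fls set" where
  "\<mm> \<equiv> semigroup_ring (H - {0})"

text \<open>
  Write \<open>x = c + x'\<close> with \<open>c\<close> constant. Then \<open>c y = 1 - x' y\<close> for the inverse
  \<open>y\<close>, so each nonzero exponent of \<open>y\<close> is the sum of an element of \<open>H\<close> and a smaller
  exponent of \<open>y\<close>.
\<close>

lemma inverse_mem:
  fixes x :: "'k::field fls"
  assumes x: "x \<in> semigroup_ring H" "x $$ 0 \<noteq> 0"
  shows "inverse x \<in> semigroup_ring H"
proof -
  define y where "y = inverse x"
  define x' where "x' = x - fls_const (x $$ 0)"
  have "x \<noteq> 0" using x by auto
  then have "x * y = 1" by (simp add: y_def)
  then have y: "fls_const (x $$ 0) * y = 1 - x' * y" by (simp add: x'_def algebra_simps)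
  have x': "i \<in> H" "0 < i" if "x' $$ i \<noteq> 0" for i
  proof -
    have "i \<noteq> 0" "x $$ i \<noteq> 0" using that by (auto simp: x'_def split: if_splits)
    then show "i \<in> H" "0 < i" using x nonneg[of i] by (force simp: semigroup_ring_def)+
  qed
  have "z \<in> H" if "y $$ z \<noteq> 0" for z
    using that
  proof (induction "nat (z - fls_subdegree y)" arbitrary: z rule: less_induct)
    case less
    show ?case
    proof (rule ccontr)
      assume z: "z \<notin> H"
      then have "z \<noteq> 0" using zero_mem by auto
      then have "x $$ 0 * y $$ z = - (x' * y) $$ z"
        using arg_cong[OF y, of "\<lambda>f. f $$ z"] by simp
      then have "(x' * y) $$ z \<noteq> 0" using less.prems x by auto
      then obtain i where i: "x' $$ i \<noteq> 0" "y $$ (z - i) \<noteq> 0" using fls_nth_mult_nonzeroD by blast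
      have "fls_subdegree y \<le> z - i" using i by (intro fls_subdegree_leI)
      then have "z - i \<in> H" using less.hyps[of "z - i"] x'[OF i(1)] i by auto
      then show False using add_mem[of i "z - i"] x'[OF i(1)] z by simp
    qed
  qed
  then show ?thesis unfolding y_def semigroup_ring_def by blast
qed

lemma mem_maximal_ideal_iff: "x \<in> \<mm> \<longleftrightarrow> x \<in> semigroup_ring H \<and> x $$ 0 = (0::'k::field)"
  by (auto simp: semigroup_ring_def)

lemma ideal_maximal_ideal: "ideal \<mm> (R :: 'k::field fls ring)"
  unfolding ideal_R_iff
proof (intro conjI ballI)
  fix a x :: "'k fls" assume "a \<in> semigroup_ring H" "x \<in> \<mm>"
  then show "a * x \<in> \<mm>"
    by (rule semigroup_ring_mult) (rule add_mem_nonzero)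
qed (auto simp: semigroup_ring_add semigroup_ring_zero intro: subsetD[OF semigroup_ring_mono, rotated])

lemma proper_ideal_subset:
  assumes "ideal J (R :: 'k::field fls ring)" "J \<noteq> semigroup_ring H"
  shows "J \<subseteq> \<mm>"
proof (rule subsetI, rule ccontr)
  fix x assume x: "x \<in> J" "x \<notin> \<mm>"
  have J: "J \<subseteq> semigroup_ring H" "\<forall>a\<in>semigroup_ring H. \<forall>x\<in>J. a * x \<in> J"
    using assms(1) unfolding ideal_R_iff by auto
  have u: "x \<in> semigroup_ring H" "x $$ 0 \<noteq> 0" using x J mem_maximal_ideal_iff by auto
  have "y \<in> J" if "y \<in> semigroup_ring H" for y
  proof -
    have "(y * inverse x) * x \<in> J"
      using J(2) x(1) semigroup_ring_mult_closed[OF that inverse_mem[OF u]] by blast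
    moreover have "x \<noteq> 0" using u by auto
    ultimately show ?thesis by (simp add: mult.assoc)
  qed
  with J assms(2) show False by auto
qed

lemma maximal_ideals: "{J. maximalideal J (R :: 'k::field fls ring)} = {\<mm>}"
proof -
  have ne: "(\<mm> :: 'k fls set) \<noteq> semigroup_ring H"
    using mem_maximal_ideal_iff[of 1] semigroup_ring_one[OF zero_mem] by auto
  have sub: "(\<mm> :: 'k fls set) \<subseteq> semigroup_ring H" by (rule semigroup_ring_mono) auto
  have "maximalideal \<mm> (R :: 'k fls ring)"
  proof (rule maximalidealI[OF ideal_maximal_ideal])
    show "carrier R \<noteq> (\<mm> :: 'k fls set)" using ne by simp
    show "J = \<mm> \<or> J = carrier R" if "ideal J R" "\<mm> \<subseteq> J" for J :: "'k fls set"
      using proper_ideal_subset[OF that(1)] that(2) by auto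
  qed
  moreover have "J = \<mm>" if J: "maximalideal J (R :: 'k fls ring)" for J
  proof -
    interpret maximalideal J R by (rule J)
    have "J \<subseteq> \<mm>" using proper_ideal_subset[OF is_ideal] I_notcarr by auto
    then show ?thesis using I_maximal[OF ideal_maximal_ideal] sub ne by auto
  qed
  ultimately show ?thesis by blast
qed

lemma ideal_prod_subset:
  fixes I J :: "'k::field fls set"
  assumes "I \<subseteq> semigroup_ring A" "J \<subseteq> semigroup_ring B" "\<And>a b. a \<in> A \<Longrightarrow> b \<in> B \<Longrightarrow> a + b \<in> C"
  shows "ideal_prod R I J \<subseteq> semigroup_ring C"
proof
  fix x assume "x \<in> ideal_prod R I J"
  then show "x \<in> semigroup_ring C"
  proof induction
    case (prod i j)
    then have "i * j \<in> semigroup_ring C" using assms by (intro semigroup_ring_mult[of i A j B]) auto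
    then show ?case by simp
  qed (simp add: semigroup_ring_add)
qed

text \<open>
  An ideal product consists of finite sums only. Still it contains every series with exponents in
  \<open>A + B\<close>: finitely many monomials are treated one by one, and the remaining tail is a single
  product, since dividing it by \<open>t^a0\<close> leaves only exponents that are so large that they lie in
  \<open>B\<close>.
\<close>

lemma ideal_prod_semigroup_ring:
  assumes A: "A \<noteq> {}" and B: "B \<noteq> {}" "\<And>h b. h \<in> H \<Longrightarrow> b \<in> B \<Longrightarrow> h + b \<in> B"
  shows "ideal_prod R (semigroup_ring A) (semigroup_ring B :: 'k::field fls set)
    = semigroup_ring {a + b | a b. a \<in> A \<and> b \<in> B}" (is "?P = ?S")
proof
  show "?P \<subseteq> ?S" by (rule ideal_prod_subset) auto
  have mult: "x * y \<in> ?P" if "x \<in> semigroup_ring A" "y \<in> semigroup_ring B" for x y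
    using ideal_prod.prod[OF that, of R] by simp
  have add: "x + y \<in> ?P" if "x \<in> ?P" "y \<in> ?P" for x y
    using ideal_prod.sum[OF that] by simp
  have zero: "0 \<in> ?P" using mult[of 0 0] semigroup_ring_zero by auto
  have sum: "sum f X \<in> ?P" if "finite X" "\<And>i. i \<in> X \<Longrightarrow> f i \<in> ?P" for f and X :: "int set"
    using that by (induction X) (auto simp: zero add)
  obtain a0 b0 where ab: "a0 \<in> A" "b0 \<in> B" using A B by auto
  show "?S \<subseteq> ?P"
  proof
    fix x assume x: "x \<in> ?S"
    obtain I y where I: "finite I" "\<And>i. i \<in> I \<Longrightarrow> x $$ i \<noteq> 0"
      and xy: "x = (\<Sum>i\<in>I. fls_const (x $$ i) * fls_X_intpow i) + y"
      and y: "\<And>z. y $$ z = (if z < a0 + b0 + F + 1 then 0 else x $$ z)"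
      by (rule fls_truncate[of x "a0 + b0 + F + 1"]) blast
    have "fls_X_intpow (-a0) * y \<in> semigroup_ring B"
      unfolding semigroup_ring_def
    proof clarify
      fix z assume "(fls_X_intpow (-a0) * y) $$ z \<noteq> 0"
      then have "F < z - b0" using y by (auto split: if_splits)
      then have "(z - b0) + b0 \<in> B" using ab by (intro B above_frobenius)
      then show "z \<in> B" by simp
    qed
    then have "fls_X_intpow a0 * (fls_X_intpow (-a0) * y) \<in> ?P"
      by (intro mult semigroup_ring_monom ab)
    moreover have "fls_X_intpow a0 * (fls_X_intpow (-a0) * y) = y" by (rule fls_eqI) simp
    ultimately have "y \<in> ?P" by (simp only:)
    moreover have "fls_const (x $$ i) * fls_X_intpow i \<in> ?P" if "i \<in> I" for i
    proof -
      have "i \<in> {a + b | a b. a \<in> A \<and> b \<in> B}" using x I(2)[OF that] by (auto simp: semigroup_ring_def)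
      then obtain a b where i: "i = a + b" "a \<in> A" "b \<in> B" by blast
      have "fls_const (x $$ i) * fls_X_intpow a \<in> semigroup_ring A"
        using i by (auto simp: semigroup_ring_def split: if_splits)
      then have "(fls_const (x $$ i) * fls_X_intpow a) * fls_X_intpow b \<in> ?P"
        using i by (intro mult semigroup_ring_monom)
      moreover have "(fls_const (x $$ i) * fls_X_intpow a) * fls_X_intpow b = fls_const (x $$ i) * fls_X_intpow i"
        by (simp add: i mult.assoc fls_X_intpow_times_fls_X_intpow[of a b, simplified])
      ultimately show ?thesis by simp
    qed
    ultimately show "x \<in> ?P" by (subst xy) (intro add sum I)
  qed
qed

text \<open>The exponents that occur in the powers of the maximal ideal.\<close>

primrec mpow :: "nat \<Rightarrow> int set" where
  "mpow 0 = H"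
| "mpow (Suc s) = {a + b | a b. a \<in> mpow s \<and> b \<in> H - {0}}"

lemma mpow_add: "h \<in> H \<Longrightarrow> a \<in> mpow s \<Longrightarrow> h + a \<in> mpow s"
proof (induction s arbitrary: a)
  case (Suc s)
  then obtain b c where "a = b + c" "b \<in> mpow s" "c \<in> H - {0}" by auto
  moreover from this have "h + b \<in> mpow s" using Suc by blast
  moreover have "h + a = (h + b) + c" using calculation by simp
  ultimately show ?case unfolding mpow.simps by blast
qed (simp add: add_mem)

lemma mpow_Suc_multiplicity: "a \<in> mpow s \<Longrightarrow> a + e \<in> mpow (Suc s)"
  using multiplicity_mem multiplicity_pos by auto

lemma multiple_mem_mpow: "int s * e \<in> mpow s"
proof (induction s)
  case (Suc s)
  then show ?case using mpow_Suc_multiplicity[OF Suc] by (simp only: of_nat_Suc distrib_right mult_1 add.commute)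
qed (simp add: zero_mem)

lemma mpow_ge: "a \<in> mpow s \<Longrightarrow> int s * e \<le> a"
proof (induction s arbitrary: a)
  case (Suc s)
  then obtain b c where "a = b + c" "b \<in> mpow s" "c \<in> H - {0}" by auto
  then show ?case using Suc.IH[of b] multiplicity_le[of c] by (simp add: algebra_simps)
qed (simp add: nonneg)

lemma maximal_ideal_pow: "\<mm> [^]\<^bsub>ideals_set (R :: 'k::field fls ring)\<^esub> (s::nat) = semigroup_ring (mpow s)"
proof (induction s)
  case 0
  show ?case by (simp add: nat_pow_def ideals_set_def)
next
  case (Suc s)
  interpret ids: comm_monoid "ideals_set (R :: 'k fls ring)"
    by (rule cring.ideals_set_is_comm_monoid[OF cring_R])
  have "\<mm> [^]\<^bsub>ideals_set (R :: 'k fls ring)\<^esub> Suc s = ideal_prod R (semigroup_ring (mpow s)) \<mm>"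
    by (simp only: ids.nat_pow_Suc Suc) (simp add: ideals_set_def)
  also have "\<dots> = semigroup_ring {a + b | a b. a \<in> mpow s \<and> b \<in> H - {0}}"
  proof (rule ideal_prod_semigroup_ring)
    show "mpow s \<noteq> {}" using multiple_mem_mpow by blast
    show "H - {0} \<noteq> {}" using multiplicity_mem multiplicity_pos by auto
  qed (rule add_mem_nonzero)
  finally show ?case by simp
qed

text \<open>
  This says that \<open>t^e\<close> generates a reduction of the maximal ideal. The sets
  \<open>mpow s - s e\<close> increase with \<open>s\<close> and lie between \<open>H\<close> and the natural numbers, so
  they can differ only in finitely many places and become constant.
\<close>

lemma mpow_stable: "\<exists>s. mpow (Suc s) = {z. z - e \<in> mpow s}"
proof -
  define D where "D s = {z. z + int s * e \<in> mpow s}" for s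
  have D_Suc: "D s \<subseteq> D (Suc s)" for s
  proof
    fix z assume "z \<in> D s"
    then have "z + int s * e + e \<in> mpow (Suc s)" unfolding D_def by (intro mpow_Suc_multiplicity) simp
    then show "z \<in> D (Suc s)" unfolding D_def by (simp only: mem_Collect_eq of_nat_Suc distrib_right mult_1 add.assoc add.commute[of e])
  qed
  have H_D: "H \<subseteq> D s" for s
  proof (induction s)
    case 0
    show ?case by (simp add: D_def)
  qed (use D_Suc in blast)
  have D_nonneg: "0 \<le> z" if "z \<in> D s" for z s
    using mpow_ge[of "z + int s * e" s] that by (simp add: D_def)
  define c where "c s = card (D s \<inter> {0..F})" for s
  have "c s < card {0..F} + 1" for s
    unfolding c_def using card_mono[of "{0..F}" "D s \<inter> {0..F}"] by simp
  then obtain s where s: "\<And>s'. c s' \<le> c s"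
    using ex_has_greatest_nat[of "\<lambda>_. True" 0 c "card {0..F} + 1"] by auto
  have "D s \<inter> {0..F} = D (Suc s) \<inter> {0..F}"
    using D_Suc[of s] s[of "Suc s"] by (intro card_seteq) (auto simp: c_def)
  moreover have "z \<in> D s" if "z \<in> D (Suc s)" "\<not> z \<le> F" for z
    using H_D[of s] above_frobenius[of z] that by auto
  ultimately have "D (Suc s) \<subseteq> D s" using D_nonneg[of _ "Suc s"] by force
  with D_Suc[of s] have D: "D (Suc s) = D s" by auto
  have "z \<in> mpow (Suc s) \<longleftrightarrow> z - e \<in> mpow s" for z
  proof -
    have "z \<in> mpow (Suc s) \<longleftrightarrow> z - int (Suc s) * e \<in> D (Suc s)" by (simp only: D_def mem_Collect_eq diff_add_cancel)
    also have "\<dots> \<longleftrightarrow> z - int (Suc s) * e \<in> D s" by (simp only: D)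
    also have "\<dots> \<longleftrightarrow> z - e \<in> mpow s" by (simp add: D_def algebra_simps)
    finally show ?thesis .
  qed
  then show ?thesis by blast
qed

section \<open>Canonical reductions of numerical semigroup rings\<close>

text \<open>
  Let \<open>I = K : L\<close> and \<open>J = L : K\<close>. All products \<open>i j\<close> lie in \<open>K : K = R\<close>. If
  all of them were in the maximal ideal, then \<open>t^F I J \<subseteq> K\<close>, which gives
  \<open>t^F \<in> L : J = K\<close>, contradicting \<open>F \<notin> KH\<close>. So some \<open>i j\<close> is a unit, and
  then \<open>I\<close> is generated by \<open>i\<close>, hence \<open>L = K : I = K / i\<close>.
\<close>

lemma canonical_ideal_unique:
  fixes L :: "'k::field fls set"
  assumes L: "canonical_ideal laurent_field (semigroup_ring H) L"
  obtains c where "L = (\<lambda>x. c * x) ` semigroup_ring KH"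
proof -
  let ?C = "colon_ideal laurent_field"
  let ?K = "semigroup_ring KH :: 'k fls set"
  define I J where "I = ?C ?K L" and "J = ?C L ?K"
  have Lreg: "0 \<in> L" "\<forall>x\<in>L. \<forall>y\<in>L. x + y \<in> L" "\<forall>a\<in>semigroup_ring H. \<forall>x\<in>L. a * x \<in> L" "L \<noteq> {0}"
    using L unfolding canonical_ideal_def regular_fractional_ideal_iff by auto
  have KI: "?C ?K I = L" unfolding I_def by (rule colon_K_colon_K[OF Lreg])
  have LJ: "?C L J = ?K" unfolding J_def using L regular_fractional_ideal_K by (auto simp: canonical_ideal_def)
  have IJ: "i * j \<in> semigroup_ring H" if "i \<in> I" "j \<in> J" for i j
  proof -
    have "(i * j) * x \<in> ?K" if "x \<in> ?K" for x
      using \<open>i \<in> I\<close> \<open>j \<in> J\<close> that by (auto simp: I_def J_def colon_ideal_laurent mult.assoc)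
    then show ?thesis unfolding colon_K_K[symmetric] by (simp add: colon_ideal_laurent)
  qed
  have "\<exists>i\<in>I. \<exists>j\<in>J. (i * j) $$ 0 \<noteq> 0"
  proof (rule ccontr)
    assume *: "\<not> ?thesis"
    have m: "fls_X_intpow F * (i * j) \<in> ?K" if "i \<in> I" "j \<in> J" for i j
    proof (rule semigroup_ring_mult[OF semigroup_ring_monom[of _ "{F}"]])
      show "i * j \<in> \<mm>" using IJ[OF that] * that by (auto simp: mem_maximal_ideal_iff)
      show "a + b \<in> KH" if "a \<in> {F}" "b \<in> H - {0}" for a b
        using that nonneg[of b] nonneg[of "- b"] by auto
    qed simp
    have "fls_X_intpow F \<in> ?C L J"
      unfolding KI[symmetric] using m by (auto simp: colon_ideal_laurent mult.assoc mult.commute)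
    then have "fls_X_intpow F \<in> ?K" using LJ by simp
    then show False using mem_K_nth_frobenius by force
  qed
  then obtain i j where ij: "i \<in> I" "j \<in> J" "(i * j) $$ 0 \<noteq> 0" by blast
  have i0: "i \<noteq> 0" and j0: "j \<noteq> 0" using ij by auto
  have u: "inverse (i * j) \<in> semigroup_ring H" using inverse_mem[OF IJ] ij by auto
  have "L = (\<lambda>x. inverse i * x) ` ?K"
  proof
    show "L \<subseteq> (\<lambda>x. inverse i * x) ` ?K"
    proof
      fix x assume "x \<in> L"
      then have "i * x \<in> ?K" using ij by (auto simp: I_def colon_ideal_laurent)
      moreover have "x = inverse i * (i * x)" using i0 by simp
      ultimately show "x \<in> (\<lambda>x. inverse i * x) ` ?K" by (rule image_eqI[rotated])
    qed
    show "(\<lambda>x. inverse i * x) ` ?K \<subseteq> L"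
    proof (clarify)
      fix x assume x: "x \<in> ?K"
      have "inverse i * x * y \<in> ?K" if "y \<in> I" for y
      proof -
        have "(inverse (i * j) * (y * j)) * x \<in> ?K"
          by (rule K_mult_closed[OF semigroup_ring_mult_closed[OF u IJ[OF that ij(2)]] x])
        moreover have "(inverse (i * j) * (y * j)) * x = inverse i * x * y"
          using i0 j0 by (simp add: field_simps)
        ultimately show ?thesis by (simp only:)
      qed
      then show "inverse i * x \<in> L" unfolding KI[symmetric] by (simp add: colon_ideal_laurent)
    qed
  qed
  then show ?thesis by (rule that)
qed

text \<open>
  For the partial order \<open>x \<le> y\<close> iff \<open>y - x \<in> H\<close>, the pseudo-Frobenius numbers are
  the maximal gaps, and every gap lies below a maximal one.
\<close>

lemma exists_pseudo_frobenius_above: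
  assumes "x \<notin> H"
  obtains f where "f \<in> pseudo_frobenius H" "f - x \<in> H"
proof -
  define A where "A = {y. y \<notin> H \<and> y - x \<in> H}"
  have "A \<subseteq> {x..F}" using nonneg above_frobenius unfolding A_def by force
  then have fin: "finite A" by (rule finite_subset) simp
  have "x \<in> A" using assms zero_mem by (simp add: A_def)
  then have max: "Max A \<in> A" "\<And>y. y \<in> A \<Longrightarrow> y \<le> Max A" using fin Max_in by auto
  have "Max A + h \<in> H" if "h \<in> H" "h \<noteq> 0" for h
  proof (rule ccontr)
    assume "Max A + h \<notin> H"
    then have "Max A + h \<in> A" using max(1) add_mem[of "Max A - x" h] that(1)
      by (auto simp: A_def algebra_simps)
    then show False using max(2) nonneg[OF that(1)] that(2) by force
  qed
  then show ?thesis using max(1) by (intro that[of "Max A"]) (auto simp: A_def pseudo_frobenius_def)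
qed

theorem has_canonical_reduction_iff:
  "has_canonical_reduction TYPE('k::field) H \<longleftrightarrow> (\<forall>f\<in>pseudo_frobenius H. e + F - f \<in> H)"
proof
  assume "has_canonical_reduction TYPE('k) H"
  then obtain L :: "'k fls set" where L: "canonical_ideal laurent_field (semigroup_ring H) L"
    and red: "is_reduction R L \<mm>"
    unfolding has_canonical_reduction_def ring_has_canonical_reduction_def maximal_ideals by auto
  have Lm: "L \<subseteq> \<mm>" using red by (auto simp: is_reduction_def)
  have m_ge: "(\<mm> :: 'k fls set) \<subseteq> semigroup_ring {e..}"
    using multiplicity_le by (intro semigroup_ring_mono) auto
  \<comment> \<open>All elements of \<open>\<mm>\<^sup>s\<close> have order at least \<open>s e\<close>, so if \<open>L\<close> had
    only elements of order above \<open>e\<close>, then \<open>t^((s + 1) e)\<close> could not lie in \<open>L \<mm>\<^sup>s\<close>.\<close>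
  have "\<not> L \<subseteq> semigroup_ring {e + 1..}"
  proof
    assume *: "L \<subseteq> semigroup_ring {e + 1..}"
    obtain s :: nat where s: "ideal_prod R L (semigroup_ring (mpow s)) = semigroup_ring (mpow (Suc s))"
      using red unfolding is_reduction_def maximal_ideal_pow by blast
    have "ideal_prod R L (semigroup_ring (mpow s)) \<subseteq> semigroup_ring {int (Suc s) * e + 1..}"
      by (rule ideal_prod_subset[OF * order_refl]) (use mpow_ge in \<open>fastforce simp: algebra_simps\<close>)
    moreover have "fls_X_intpow (int (Suc s) * e) \<in> (semigroup_ring (mpow (Suc s)) :: 'k fls set)"
      by (intro semigroup_ring_monom multiple_mem_mpow)
    ultimately have "fls_X_intpow (int (Suc s) * e) \<in> (semigroup_ring {int (Suc s) * e + 1..} :: 'k fls set)"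
      using s by blast
    then show False unfolding semigroup_ring_def mem_Collect_eq
      by (auto dest: spec[of _ "int (Suc s) * e"])
  qed
  then obtain x z where x: "x \<in> L" "x $$ z \<noteq> 0" "\<not> e + 1 \<le> z"
    by (auto simp: semigroup_ring_def)
  moreover have "x \<in> semigroup_ring {e..}" using x Lm m_ge by blast
  then have "e \<le> z" using x by (simp add: semigroup_ring_def)
  ultimately have "z = e" by linarith
  with x have xe: "x $$ e \<noteq> 0" by simp
  obtain c where c: "L = (\<lambda>x. c * x) ` semigroup_ring KH"
    using canonical_ideal_unique[OF L] .
  then have "c * 1 \<in> L" using one_mem_K by blast
  then have "c \<in> semigroup_ring {e..}" using Lm m_ge by auto
  then have c_ge: "e \<le> z" if "c $$ z \<noteq> 0" for z using that by (simp add: semigroup_ring_def)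
  obtain y where y: "y \<in> semigroup_ring KH" "x = c * y" using x c by blast
  then obtain i where i: "c $$ i \<noteq> 0" "y $$ (e - i) \<noteq> 0" using xe fls_nth_mult_nonzeroD by blast
  then have "0 \<le> e - i" using y KH_nonneg[of "e - i"] by (auto simp: semigroup_ring_def)
  then have "i = e" using c_ge[OF i(1)] by linarith
  with i have ce: "c $$ e \<noteq> 0" by simp
  \<comment> \<open>\<open>c\<close> has order exactly \<open>e\<close>, so \<open>c t^(F - f)\<close> is an element of the ring
    whose lowest exponent is \<open>e + F - f\<close>.\<close>
  show "\<forall>f\<in>pseudo_frobenius H. e + F - f \<in> H"
  proof
    fix f assume f: "f \<in> pseudo_frobenius H"
    then have "fls_X_intpow (F - f) \<in> (semigroup_ring KH :: 'k fls set)"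
      by (intro semigroup_ring_monom) (simp add: pseudo_frobenius_def)
    then have "c * fls_X_intpow (F - f) \<in> semigroup_ring H"
      using c Lm mem_maximal_ideal_iff by blast
    moreover have "(c * fls_X_intpow (F - f)) $$ (e + F - f) \<noteq> 0" using ce by simp
    ultimately show "e + F - f \<in> H" unfolding semigroup_ring_def by blast
  qed
next
  assume pf: "\<forall>f\<in>pseudo_frobenius H. e + F - f \<in> H"
  \<comment> \<open>\<open>KH\<close> is generated over \<open>H\<close> by the elements \<open>F - f\<close>, so the hypothesis
    puts all of \<open>e + KH\<close> into \<open>H\<close>.\<close>
  have eK: "z \<in> H - {0}" if "z - e \<in> KH" for z
  proof -
    have "F - (z - e) \<notin> H" using that by simp
    then obtain f where f: "f \<in> pseudo_frobenius H" "f - (F - (z - e)) \<in> H"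
      by (rule exists_pseudo_frobenius_above)
    then have "(e + F - f) + (f - (F - (z - e))) \<in> H" using pf by (intro add_mem) auto
    then have "z \<in> H" by simp
    then show ?thesis using KH_nonneg[OF that] multiplicity_pos by auto
  qed
  define L :: "'k fls set" where "L = semigroup_ring {z. z - e \<in> KH}"
  have L_eq: "L = (\<lambda>x. fls_X_intpow e * x) ` semigroup_ring KH"
    unfolding L_def by (rule semigroup_ring_translate)
  have Lm: "L \<subseteq> \<mm>" unfolding L_def by (rule semigroup_ring_mono) (use eK in blast)
  have LH: "L \<subseteq> semigroup_ring H" unfolding L_def by (rule semigroup_ring_mono) (use eK in blast)
  have Lmult: "a * x \<in> L" if a: "a \<in> semigroup_ring H" and x: "x \<in> L" for a x
  proof -
    obtain y where y: "y \<in> semigroup_ring KH" "x = fls_X_intpow e * y" using x unfolding L_eq by blast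
    have "a * x = fls_X_intpow e * (a * y)" unfolding y by (rule mult.left_commute)
    then show ?thesis unfolding L_eq using K_mult_closed[OF a y(1)] by blast
  qed
  have Lideal: "ideal L R"
    unfolding ideal_R_iff using LH Lmult semigroup_ring_add semigroup_ring_zero unfolding L_def by auto
  have eL: "fls_X_intpow e \<in> L" using one_mem_K unfolding L_eq by force
  have "canonical_ideal laurent_field (semigroup_ring H) L"
    unfolding canonical_ideal_def
  proof (intro conjI allI impI)
    show "ideal L (laurent_field\<lparr>carrier := semigroup_ring H\<rparr>)" by (rule Lideal)
    have "1 \<in> semigroup_ring H - {0 :: 'k fls}" using semigroup_ring_one[OF zero_mem] by simp
    moreover have "\<forall>x\<in>L. 1 * x \<in> semigroup_ring H" using LH by auto
    moreover have "L \<noteq> {0}" using eL fls_X_intpow_nonzero by blast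
    ultimately show "regular_fractional_ideal laurent_field (semigroup_ring H) L"
      unfolding regular_fractional_ideal_iff using Lideal unfolding ideal_R_iff by blast
  next
    fix J :: "'k fls set" assume J: "regular_fractional_ideal laurent_field (semigroup_ring H) J"
    have "colon_ideal laurent_field L (colon_ideal laurent_field L J)
      = colon_ideal laurent_field (semigroup_ring KH) (colon_ideal laurent_field (semigroup_ring KH) J)"
      unfolding L_eq by (rule double_colon_ideal_image) simp
    also have "\<dots> = J" by (rule colon_K_colon_K) (use J in \<open>auto simp: regular_fractional_ideal_iff\<close>)
    finally show "colon_ideal laurent_field L (colon_ideal laurent_field L J) = J" .
  qed
  moreover have "is_reduction R L \<mm>"
  proof -
    obtain s where s: "mpow (Suc s) = {z. z - e \<in> mpow s}" using mpow_stable by blast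
    have "ideal_prod R L (semigroup_ring (mpow s)) = semigroup_ring {a + b | a b. a \<in> {z. z - e \<in> KH} \<and> b \<in> mpow s}"
      unfolding L_def
    proof (rule ideal_prod_semigroup_ring)
      show "{z. z - e \<in> KH} \<noteq> {}" using zero_KH by (auto intro!: exI[of _ e])
      show "mpow s \<noteq> {}" using multiple_mem_mpow by blast
    qed (rule mpow_add)
    also have "{a + b | a b. a \<in> {z. z - e \<in> KH} \<and> b \<in> mpow s} = mpow (Suc s)" (is "?A = _")
    proof
      show "?A \<subseteq> mpow (Suc s)"
      proof
        fix z assume "z \<in> ?A"
        then obtain a b where "z = a + b" "a - e \<in> KH" "b \<in> mpow s" by blast
        then have "z = b + a" "b \<in> mpow s" "a \<in> H - {0}" using eK[of a] by auto
        then show "z \<in> mpow (Suc s)" unfolding mpow.simps by blast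
      qed
      show "mpow (Suc s) \<subseteq> ?A"
      proof
        fix z assume "z \<in> mpow (Suc s)"
        then have "z - e \<in> mpow s" using s by blast
        then show "z \<in> ?A" using zero_KH by (intro CollectI exI[of _ e] exI[of _ "z - e"]) auto
      qed
    qed
    finally show ?thesis unfolding is_reduction_def maximal_ideal_pow using Lideal Lm by blast
  qed
  ultimately show "has_canonical_reduction TYPE('k) H"
    unfolding has_canonical_reduction_def ring_has_canonical_reduction_def maximal_ideals by blast
qed

end

section \<open>Minimal lengths of expressions\<close>

text \<open>Two of the \<open>n + 1\<close> shortest prefixes have the same sum modulo \<open>n\<close>.\<close>

lemma exists_block_dvd_sum_list:
  fixes xs :: "nat list"
  assumes "n > 0" "n \<le> length xs"
  obtains as ys bs where "xs = as @ ys @ bs" "ys \<noteq> []" "n dvd sum_list ys"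
proof -
  define f where "f i = sum_list (take i xs) mod n" for i
  have "\<not> inj_on f {0..n}"
  proof
    assume "inj_on f {0..n}"
    then have "card {0..n} \<le> card {0..<n}"
      by (rule card_inj_on_le) (use assms in \<open>auto simp: f_def\<close>)
    then show False by simp
  qed
  then obtain i j where ij: "i < j" "j \<le> n" "f i = f j"
    unfolding inj_on_def by (metis atLeastAtMost_iff linorder_neqE_nat)
  define ys where "ys = take (j - i) (drop i xs)"
  have take: "take j xs = take i xs @ ys"
    using ij take_add[of i "j - i" xs] by (simp add: ys_def)
  have "sum_list (take i xs) mod n = (sum_list (take i xs) + sum_list ys) mod n"
    using ij(3) unfolding f_def take by simp
  then have "n dvd (sum_list (take i xs) + sum_list ys) - sum_list (take i xs)"
    by (metis mod_eq_dvd_iff_nat le_add1)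
  then have "n dvd sum_list ys" by simp
  moreover have "ys \<noteq> []" using ij assms by (simp add: ys_def)
  moreover have "xs = take i xs @ ys @ drop j xs"
    by (metis append.assoc append_take_drop_id take)
  ultimately show ?thesis using that by blast
qed

lemma Gcd_image_bezout:
  fixes r :: "nat \<Rightarrow> nat"
  assumes "finite A"
  shows "\<exists>x. int (Gcd (r ` A)) = (\<Sum>j\<in>A. x j * int (r j))"
  using assms
proof induction
  case (insert a A)
  then obtain x where x: "int (Gcd (r ` A)) = (\<Sum>j\<in>A. x j * int (r j))" by blast
  obtain u v where uv: "u * int (r a) + v * int (Gcd (r ` A)) = gcd (int (r a)) (int (Gcd (r ` A)))"
    using bezout_int by blast
  have "int (Gcd (r ` insert a A)) = u * int (r a) + v * int (Gcd (r ` A))"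
    unfolding uv by simp
  also have "\<dots> = (\<Sum>j\<in>insert a A. (if j = a then u else v * x j) * int (r j))"
    using insert(1,2) unfolding x
    by (auto simp: sum_distrib_left mult.assoc intro!: sum.cong)
  finally show ?case by (rule exI[of _ "\<lambda>j. if j = a then u else v * x j"])
qed simp

locale shifted_family =
  fixes k :: nat and r :: "nat \<Rightarrow> nat"
  assumes k_pos: "k \<ge> 1"
    and r_0: "r 0 = 0"
    and r_mono: "strict_mono_on {0..k} r"
begin

abbreviation rk :: int where "rk \<equiv> int (r k)"
abbreviation D :: int where "D \<equiv> int (d k r)"
abbreviation ml :: "int \<Rightarrow> int" where "ml i \<equiv> int (min_length k r i)"

lemma r_less: "i < j \<Longrightarrow> j \<le> k \<Longrightarrow> r i < r j"
  using r_mono by (auto simp: strict_mono_on_def)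

lemma r_pos: "j \<in> {1..k} \<Longrightarrow> 0 < r j"
  using r_less[of 0 j] r_0 by simp

lemma r_le: "j \<in> {1..k} \<Longrightarrow> r j \<le> r k"
  using r_less[of j k] by (cases "j = k") auto

lemma rk_pos: "0 < rk" using r_pos[of k] k_pos by simp

lemma D_pos: "0 < D"
proof -
  have "d k r dvd r k" unfolding d_def using k_pos by (intro Gcd_dvd) auto
  then show ?thesis using rk_pos by (auto intro!: Nat.gr0I)
qed

lemma D_dvd_r: "j \<in> {1..k} \<Longrightarrow> D dvd int (r j)"
  unfolding d_def by (simp add: Gcd_dvd)

lemma D_dvd_rk: "D dvd rk" using D_dvd_r[of k] k_pos by simp

text \<open>
  Expressions are taken as lists of generators instead of coefficient vectors, because the exchange
  argument below replaces a block of consecutive summands.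
\<close>

definition has_length :: "int \<Rightarrow> nat \<Rightarrow> bool" where
  "has_length i l \<longleftrightarrow> (\<exists>xs. set xs \<subseteq> r ` {1..k} \<and> int (sum_list xs) = i \<and> length xs = l)"

lemma has_length_add: "has_length i l \<Longrightarrow> has_length i' l' \<Longrightarrow> has_length (i + i') (l + l')"
  unfolding has_length_def by (auto, rule_tac x = "xs @ xsa" in exI) auto

lemma has_length_r: "j \<in> {1..k} \<Longrightarrow> has_length (int (r j)) 1"
  unfolding has_length_def by (intro exI[of _ "[r j]"]) auto

lemma has_length_iff:
  "has_length i l \<longleftrightarrow> (\<exists>c :: nat \<Rightarrow> nat. i = (\<Sum>j\<in>{1..k}. int (c j) * int (r j)) \<and> l = (\<Sum>j\<in>{1..k}. c j))"
proof
  assume "has_length i l"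
  then obtain xs where "set xs \<subseteq> r ` {1..k}" "int (sum_list xs) = i" "length xs = l"
    by (auto simp: has_length_def)
  then show "\<exists>c :: nat \<Rightarrow> nat. i = (\<Sum>j\<in>{1..k}. int (c j) * int (r j)) \<and> l = (\<Sum>j\<in>{1..k}. c j)"
  proof (induction xs arbitrary: i l)
    case Nil
    then show ?case by (intro exI[of _ "\<lambda>_. 0"]) auto
  next
    case (Cons x xs)
    then obtain j where j: "x = r j" "j \<in> {1..k}" by auto
    obtain c where c: "int (sum_list xs) = (\<Sum>j\<in>{1..k}. int (c j) * int (r j))" "length xs = (\<Sum>j\<in>{1..k}. c j)"
      using Cons.IH[of "int (sum_list xs)" "length xs"] Cons.prems by auto
    have "(\<Sum>j'\<in>{1..k}. int ((c(j := Suc (c j))) j') * int (r j'))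
      = (\<Sum>j'\<in>{1..k}. int (c j') * int (r j') + (if j' = j then int (r j') else 0))"
      by (intro sum.cong) (auto simp: algebra_simps)
    also have "\<dots> = (\<Sum>j'\<in>{1..k}. int (c j') * int (r j')) + int (r j)"
      using j(2) by (simp add: sum.distrib)
    also have "\<dots> = i" using Cons.prems(2) unfolding c(1)[symmetric] j(1)[symmetric] by simp
    finally have "i = (\<Sum>j'\<in>{1..k}. int ((c(j := Suc (c j))) j') * int (r j'))" ..
    moreover have "(\<Sum>j'\<in>{1..k}. (c(j := Suc (c j))) j') = (\<Sum>j'\<in>{1..k}. c j' + (if j' = j then 1 else 0))"
      by (intro sum.cong) auto
    then have "(\<Sum>j'\<in>{1..k}. (c(j := Suc (c j))) j') = (\<Sum>j'\<in>{1..k}. c j') + 1"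
      using j(2) by (simp add: sum.distrib)
    then have "l = (\<Sum>j'\<in>{1..k}. (c(j := Suc (c j))) j')"
      using Cons.prems(3) unfolding c(2)[symmetric] by simp
    ultimately show ?case by blast
  qed
next
  assume "\<exists>c :: nat \<Rightarrow> nat. i = (\<Sum>j\<in>{1..k}. int (c j) * int (r j)) \<and> l = (\<Sum>j\<in>{1..k}. c j)"
  then obtain c :: "nat \<Rightarrow> nat" where c: "i = (\<Sum>j\<in>{1..k}. int (c j) * int (r j))" "l = (\<Sum>j\<in>{1..k}. c j)"
    by blast
  have mult: "has_length (int a * int (r j)) a" if "j \<in> {1..k}" for a j
    unfolding has_length_def using that
    by (intro exI[of _ "replicate a (r j)"]) (auto simp: sum_list_replicate)
  have "has_length (\<Sum>j\<in>A. int (c j) * int (r j)) (\<Sum>j\<in>A. c j)" if "finite A" "A \<subseteq> {1..k}" for A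
    using that
  proof induction
    case empty
    show ?case unfolding has_length_def by (intro exI[of _ "[]"]) auto
  qed (auto intro!: has_length_add mult)
  then show "has_length i l" using c by simp
qed

lemma mem_S_iff: "i \<in> S k r \<longleftrightarrow> (\<exists>l. has_length i l)"
  unfolding S_def generated_semigroup_def has_length_iff by auto

lemma min_length_eq: "min_length k r i = (LEAST l. has_length i l)"
  unfolding min_length_def has_length_iff ..

lemma has_length_min_length: "i \<in> S k r \<Longrightarrow> has_length i (min_length k r i)"
  unfolding min_length_eq mem_S_iff by (auto intro: LeastI)

lemma min_length_le: "has_length i l \<Longrightarrow> min_length k r i \<le> l"
  unfolding min_length_eq by (rule Least_le)

lemma S_add: "i \<in> S k r \<Longrightarrow> i' \<in> S k r \<Longrightarrow> i + i' \<in> S k r"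
  unfolding mem_S_iff using has_length_add by blast

lemma r_mem_S: "j \<in> {1..k} \<Longrightarrow> int (r j) \<in> S k r"
  unfolding mem_S_iff using has_length_r by blast

lemma rk_mem_S: "rk \<in> S k r" using r_mem_S k_pos by simp

lemma zero_mem_S: "0 \<in> S k r"
  unfolding mem_S_iff has_length_def by (intro exI[of _ 0] exI[of _ "[]"]) auto

lemma S_nonneg: "i \<in> S k r \<Longrightarrow> 0 \<le> i"
  unfolding mem_S_iff has_length_def by auto

lemma D_dvd_S: "i \<in> S k r \<Longrightarrow> D dvd i"
  unfolding mem_S_iff has_length_iff using D_dvd_r by (auto intro!: dvd_sum)

lemma S_add_multiple_rk: "i \<in> S k r \<Longrightarrow> i + int t * rk \<in> S k r"
proof (induction t)
  case (Suc t)
  then have "i + int t * rk + rk \<in> S k r" using S_add rk_mem_S by blast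
  then show ?case by (simp add: algebra_simps)
qed simp

lemma min_length_add: "i \<in> S k r \<Longrightarrow> i' \<in> S k r \<Longrightarrow> ml (i + i') \<le> ml i + ml i'"
  using min_length_le[OF has_length_add[OF has_length_min_length[of i] has_length_min_length[of i']]]
  by linarith

lemma min_length_rk: "ml rk \<le> 1"
  using min_length_le[OF has_length_r[of k]] k_pos by simp

lemma min_length_add_multiple_rk: "i \<in> S k r \<Longrightarrow> ml (i + int t * rk) \<le> ml i + int t"
proof (induction t)
  case (Suc t)
  have "ml (i + int t * rk + rk) \<le> ml (i + int t * rk) + ml rk"
    by (intro min_length_add S_add_multiple_rk rk_mem_S Suc)
  then show ?case using Suc min_length_rk by (simp add: algebra_simps)
qed simp

text \<open>
  Among \<open>r k\<close> summands different from \<open>r k\<close>, some block has a sum divisible by \<open>r k\<close>.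
  All its entries are smaller than \<open>r k\<close>, so replacing it by copies of \<open>r k\<close> makes the
  expression shorter. Hence a shortest expression has fewer than \<open>r k\<close> summands \<open>zs\<close> other
  than \<open>r k\<close>.
\<close>

lemma min_length_normal_form:
  assumes "i \<in> S k r"
  obtains a zs where "i = int a * rk + int (sum_list zs)" "min_length k r i = a + length zs"
    "length zs < r k" "set zs \<subseteq> r ` {1..k}"
proof -
  obtain xs where xs: "set xs \<subseteq> r ` {1..k}" "int (sum_list xs) = i" "length xs = min_length k r i"
    using has_length_min_length[OF assms] by (auto simp: has_length_def)
  define zs where "zs = filter (\<lambda>x. x \<noteq> r k) xs"
  define a where "a = length (filter (\<lambda>x. x = r k) xs)"
  have sum: "sum_list xs = a * r k + sum_list zs" unfolding a_def zs_def by (induction xs) auto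
  have len: "length xs = a + length zs" unfolding a_def zs_def by (induction xs) auto
  have set: "set zs \<subseteq> r ` {1..k}" using xs by (auto simp: zs_def)
  have lt: "x < r k" if "x \<in> set zs" for x using that set r_le unfolding zs_def by fastforce
  have "length zs < r k"
  proof (rule ccontr)
    assume "\<not> length zs < r k"
    then obtain as ys bs where zs: "zs = as @ ys @ bs" "ys \<noteq> []" "r k dvd sum_list ys"
      using exists_block_dvd_sum_list[of "r k" zs] rk_pos by (auto simp: not_less)
    then obtain q where q: "sum_list ys = r k * q" by (auto simp: dvd_def)
    have "sum_list ys < length ys * r k"
      using zs(2) lt unfolding zs(1)
    proof (induction ys rule: list_nonempty_induct)
      case (cons x xs)
      then have "x < r k" "sum_list xs < length xs * r k" by auto
      then show ?case by simp
    qed simp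
    then have "q < length ys" unfolding q using rk_pos by (simp add: mult.commute)
    have "has_length i (a + q + length as + length bs)"
      unfolding has_length_def
    proof (intro exI conjI)
      let ?xs = "replicate (a + q) (r k) @ as @ bs"
      show "set ?xs \<subseteq> r ` {1..k}" using set k_pos unfolding zs(1) by auto
      show "int (sum_list ?xs) = i"
        unfolding xs(2)[symmetric] sum zs(1) by (simp add: q sum_list_replicate algebra_simps)
    qed simp
    then have "min_length k r i \<le> a + q + length as + length bs" by (rule min_length_le)
    then show False using xs(3) len \<open>q < length ys\<close> unfolding zs(1) by simp
  qed
  moreover have "i = int a * rk + int (sum_list zs)" using xs(2) sum by simp
  ultimately show ?thesis using that xs(3) len set by metis
qed

lemma sum_list_le: "set zs \<subseteq> r ` {1..k} \<Longrightarrow> sum_list zs \<le> length zs * r k"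
  by (induction zs) (use r_le in force)+

lemma min_length_lower: "i \<in> S k r \<Longrightarrow> i \<le> rk * ml i"
proof -
  assume "i \<in> S k r"
  then obtain xs where "set xs \<subseteq> r ` {1..k}" "int (sum_list xs) = i" "length xs = min_length k r i"
    using has_length_min_length by (auto simp: has_length_def)
  then show ?thesis using sum_list_le[of xs] by (simp flip: of_nat_mult add: mult.commute)
qed

lemma min_length_upper: "i \<in> S k r \<Longrightarrow> rk * ml i \<le> i + rk\<^sup>2"
proof -
  assume "i \<in> S k r"
  then obtain a zs where i: "i = int a * rk + int (sum_list zs)" "min_length k r i = a + length zs"
    "length zs < r k" by (rule min_length_normal_form)
  have "rk * int (length zs) \<le> rk * rk" using i(3) by (intro mult_left_mono) auto
  moreover have "rk * ml i = int a * rk + rk * int (length zs)" unfolding i(2) by (simp add: algebra_simps)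
  ultimately show ?thesis using i(1) by (simp add: power2_eq_square)
qed

text \<open>
  The fewer than \<open>r k\<close> summands other than \<open>r k\<close> contribute at most \<open>(r k)^2\<close>, so a
  shortest expression of a larger element uses \<open>r k\<close> itself, which can then be removed.
\<close>

lemma min_length_large:
  assumes "i + rk \<in> S k r" "rk\<^sup>2 < i + rk"
  shows "i \<in> S k r" "ml (i + rk) = ml i + 1"
proof -
  obtain a zs where i: "i + rk = int a * rk + int (sum_list zs)" "min_length k r (i + rk) = a + length zs"
    "length zs < r k" "set zs \<subseteq> r ` {1..k}" by (rule min_length_normal_form[OF assms(1)])
  have "int (sum_list zs) \<le> int (length zs * r k)" using sum_list_le[OF i(4)] by (simp only: of_nat_le_iff)
  also have "\<dots> \<le> rk\<^sup>2" using i(3) by (simp add: power2_eq_square)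
  finally have "a \<noteq> 0" using assms(2) i(1) by (intro notI) simp
  then obtain b where b: "a = Suc b" by (cases a) auto
  have "has_length i (b + length zs)"
    unfolding has_length_def
  proof (intro exI conjI)
    show "int (sum_list (replicate b (r k) @ zs)) = i"
      using i(1) by (simp add: b sum_list_replicate algebra_simps)
  qed (use i(4) k_pos in auto)
  then show S: "i \<in> S k r" and "ml (i + rk) = ml i + 1"
  proof -
    assume l: "has_length i (b + length zs)"
    then show S: "i \<in> S k r" by (auto simp: mem_S_iff)
    show "ml (i + rk) = ml i + 1"
      using min_length_le[OF l] i(2) b min_length_add[OF S rk_mem_S] min_length_rk by linarith
  qed
qed

lemma min_length_add_multiple_rk_large:
  assumes "i \<in> S k r" "rk\<^sup>2 < i + rk"
  shows "ml (i + int t * rk) = ml i + int t"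
proof (induction t)
  case (Suc t)
  have "rk\<^sup>2 < (i + int t * rk) + rk" using assms(2) zero_le_mult_iff[of "int t" rk] by linarith
  moreover have "(i + int t * rk) + rk \<in> S k r" by (rule S_add[OF S_add_multiple_rk[OF assms(1)] rk_mem_S])
  ultimately have "ml ((i + int t * rk) + rk) = ml (i + int t * rk) + 1" by (intro min_length_large(2))
  then show ?case using Suc by (simp add: algebra_simps)
qed simp

text \<open>
  Reducing the coefficients of a Bezout representation modulo \<open>r k\<close> gives an element of
  \<open>S\<close> below a fixed bound in every residue class of multiples of \<open>d\<close> modulo \<open>r k\<close>.
\<close>

lemma large_multiples_mem_S: "\<exists>B. \<forall>s \<ge> B. D dvd s \<longrightarrow> s \<in> S k r"
proof -
  obtain x where x: "D = (\<Sum>j\<in>{1..k}. x j * int (r j))"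
    unfolding d_def using Gcd_image_bezout[of "{1..k}" r] by auto
  define B where "B = (\<Sum>j\<in>{1..k}. rk * int (r j))"
  have "s \<in> S k r" if s: "B \<le> s" "D dvd s" for s
  proof -
    obtain c where c: "s = D * c" using s by (auto simp: dvd_def)
    define y where "y j = (x j * c) mod rk" for j
    define u where "u = (\<Sum>j\<in>{1..k}. y j * int (r j))"
    have y: "0 \<le> y j" "y j \<le> rk" for j using rk_pos by (auto simp: y_def less_imp_le)
    have "u = (\<Sum>j\<in>{1..k}. int (nat (y j)) * int (r j))" unfolding u_def using y by simp
    then have "u \<in> S k r" unfolding S_def generated_semigroup_def by (auto intro!: exI[of _ "\<lambda>j. nat (y j)"])
    have "u \<le> B" unfolding u_def B_def using y by (intro sum_mono mult_right_mono) auto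
    have "rk dvd s - u"
    proof -
      have "s - u = (\<Sum>j\<in>{1..k}. (x j * c - y j) * int (r j))"
        unfolding c x u_def by (simp add: sum_distrib_right sum_distrib_left sum_subtractf algebra_simps)
      moreover have "rk dvd x j * c - y j" for j unfolding y_def by (simp add: dvd_minus_mod)
      ultimately show ?thesis by (auto intro!: dvd_sum)
    qed
    then obtain q where q: "s = u + rk * q" by (auto simp: dvd_def algebra_simps)
    then have "0 \<le> q" using \<open>u \<le> B\<close> s(1) rk_pos by (smt (verit) mult_pos_neg)
    then show ?thesis using S_add_multiple_rk[OF \<open>u \<in> S k r\<close>, of "nat q"] q by (simp add: mult.commute)
  qed
  then show ?thesis by blast
qed

text \<open>
  The greatest element in the definition of \<open>F_S\<close> exists: the multiples of \<open>d\<close> outside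
  \<open>S\<close> are bounded above, and \<open>-d\<close> is one of them.
\<close>

lemma F_S_props: "D dvd F_S k r" "- D \<le> F_S k r" "\<And>s. F_S k r < s \<Longrightarrow> D dvd s \<Longrightarrow> s \<in> S k r"
proof -
  obtain B where B: "\<And>s. B \<le> s \<Longrightarrow> D dvd s \<Longrightarrow> s \<in> S k r" using large_multiples_mem_S by blast
  define A where "A = {s \<in> {-D..B}. s \<notin> S k r \<and> D dvd s}"
  have "finite A" by (rule finite_subset[of _ "{-D..B}"]) (auto simp: A_def)
  have negD: "- D \<notin> S k r" using S_nonneg[of "- D"] D_pos by auto
  then have "- D \<le> B" using B[of "- D"] by force
  then have "- D \<in> A" using negD by (simp add: A_def)
  then have max: "Max A \<in> A" "\<And>y. y \<in> A \<Longrightarrow> y \<le> Max A" using \<open>finite A\<close> Max_in by auto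
  have "F_S k r = Max A"
    unfolding F_S_def
  proof (rule Greatest_equality)
    show "Max A \<notin> S k r \<and> [Max A = 0] (mod D)" using max(1) by (auto simp: A_def cong_0_iff)
    fix s assume s: "s \<notin> S k r \<and> [s = 0] (mod D)"
    then have "s \<le> B" using B[of s] by (force simp: cong_0_iff)
    then show "s \<le> Max A"
      using s max(2)[of s] max(2)[OF \<open>- D \<in> A\<close>] by (cases "- D \<le> s") (auto simp: A_def cong_0_iff)
  qed
  then show "D dvd F_S k r" "- D \<le> F_S k r" using max \<open>- D \<in> A\<close> by (auto simp: A_def)
  fix s assume s: "F_S k r < s" "D dvd s"
  show "s \<in> S k r"
  proof (rule ccontr)
    assume "s \<notin> S k r"
    moreover have "s \<le> B" using calculation B[of s] s by force
    moreover have "- D \<le> s" using s(1) max(2)[OF \<open>- D \<in> A\<close>] \<open>F_S k r = Max A\<close> by simp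
    ultimately have "s \<in> A" using s by (simp add: A_def)
    then show False using max(2) s \<open>F_S k r = Max A\<close> by force
  qed
qed

lemma min_length_zero: "ml 0 = 0"
  using min_length_le[of 0 0] unfolding has_length_def by auto

text \<open>
  A generator \<open>n + r j\<close> can be split off from any element of \<open>M\<close> that is not a multiple of
  \<open>n\<close>; this is the step behind it.
\<close>

lemma S_split:
  assumes "s \<in> S k r" "s \<noteq> 0"
  obtains j s' where "j \<in> {1..k}" "s' \<in> S k r" "s = int (r j) + s'" "ml s' + 1 \<le> ml s"
proof -
  obtain xs where xs: "set xs \<subseteq> r ` {1..k}" "int (sum_list xs) = s" "length xs = min_length k r s"
    using has_length_min_length[OF assms(1)] by (auto simp: has_length_def)
  then obtain x ys where x: "xs = x # ys" using assms(2) by (cases xs) auto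
  then obtain j where j: "j \<in> {1..k}" "x = r j" using xs by auto
  have l: "has_length (int (sum_list ys)) (length ys)" unfolding has_length_def using xs x by auto
  show ?thesis
  proof (rule that[OF j(1)])
    show "int (sum_list ys) \<in> S k r" using l mem_S_iff by blast
    show "s = int (r j) + int (sum_list ys)" using xs x j by simp
    show "ml (int (sum_list ys)) + 1 \<le> ml s" using min_length_le[OF l] xs(3) x by simp
  qed
qed

end

section \<open>Apery sets and pseudo-Frobenius numbers of the shifted semigroups\<close>

text \<open>
  The single bound \<open>n_large\<close> supplies all estimates of this section: it makes \<open>n\<close> larger than
  the error \<open>(r k)^2\<close> in the comparison of \<open>i\<close> with \<open>r k\<close> times the minimal length, and
  larger than the width of the window \<open>{d n - r k..d n + F_S}\<close>.
\<close>

locale shifted_semigroup = shifted_family +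
  fixes n :: nat
  assumes coprime_n_d: "coprime n (d k r)"
    and n_large: "F_S k r + rk + rk\<^sup>2 < int n"
begin

abbreviation Ap :: "int set" where "Ap \<equiv> Apery (S k r) (D * int n)"
abbreviation g :: "int \<Rightarrow> int" where "g i \<equiv> ml i * int n + i"

lemma D_le_rk: "D \<le> rk" using D_dvd_rk rk_pos by (intro zdvd_imp_le)

lemma rk_sq_less: "rk\<^sup>2 < int n" using n_large F_S_props(2) D_le_rk by linarith

lemma n_pos: "0 < int n" using rk_sq_less zero_le_power2[of rk] by linarith

lemma n_le_Dn: "int n \<le> D * int n" using D_pos n_pos by simp

lemma F_S_less_Dn: "F_S k r + rk + rk\<^sup>2 < D * int n" using n_large n_le_Dn by linarith

lemma F_S_rk_less_Dn: "F_S k r + rk < D * int n" using F_S_less_Dn zero_le_power2[of rk] by linarith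

lemma mem_M_iff: "a \<in> M k r n \<longleftrightarrow> (\<exists>L s. s \<in> S k r \<and> ml s \<le> L \<and> a = L * int n + s)"
proof
  assume "a \<in> M k r n"
  then obtain c :: "nat \<Rightarrow> nat" where c: "a = (\<Sum>j\<in>{0..k}. int (c j) * (int n + int (r j)))"
    by (auto simp: M_def generated_semigroup_def)
  define s where "s = (\<Sum>j\<in>{1..k}. int (c j) * int (r j))"
  have s: "has_length s (\<Sum>j\<in>{1..k}. c j)" unfolding has_length_iff s_def by blast
  have split: "(\<Sum>j\<in>{0..k}. f j) = f 0 + (\<Sum>j\<in>{1..k}. f j)" for f :: "nat \<Rightarrow> int"
    by (simp add: sum.atLeast_Suc_atMost)
  have "a = (int (c 0) + int (\<Sum>j\<in>{1..k}. c j)) * int n + s"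
    unfolding c split s_def by (simp add: r_0 distrib_left distrib_right sum.distrib sum_distrib_right)
  moreover have "ml s \<le> int (c 0) + int (\<Sum>j\<in>{1..k}. c j)" using min_length_le[OF s] by linarith
  ultimately show "\<exists>L s. s \<in> S k r \<and> ml s \<le> L \<and> a = L * int n + s" using s mem_S_iff by blast
next
  assume "\<exists>L s. s \<in> S k r \<and> ml s \<le> L \<and> a = L * int n + s"
  then obtain L s where s: "s \<in> S k r" "ml s \<le> L" "a = L * int n + s" by blast
  obtain c :: "nat \<Rightarrow> nat" where c: "s = (\<Sum>j\<in>{1..k}. int (c j) * int (r j))" "min_length k r s = (\<Sum>j\<in>{1..k}. c j)"
    using has_length_min_length[OF s(1)] unfolding has_length_iff by blast
  define c' where "c' = c(0 := nat (L - ml s))"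
  have split: "(\<Sum>j\<in>{0..k}. f j) = f 0 + (\<Sum>j\<in>{1..k}. f j)" for f :: "nat \<Rightarrow> int"
    by (simp add: sum.atLeast_Suc_atMost)
  have "(\<Sum>j\<in>{0..k}. int (c' j) * (int n + int (r j)))
      = (L - ml s) * int n + (\<Sum>j\<in>{1..k}. int (c j) * (int n + int (r j)))"
    unfolding split using s(2) by (simp add: c'_def r_0)
  also have "(\<Sum>j\<in>{1..k}. int (c j) * (int n + int (r j))) = ml s * int n + s"
    by (subst (2) c(1), subst c(2)) (simp add: distrib_left sum.distrib sum_distrib_right)
  finally have "a = (\<Sum>j\<in>{0..k}. int (c' j) * (int n + int (r j)))" using s(3) by (simp add: algebra_simps)
  then show "a \<in> M k r n" unfolding M_def generated_semigroup_def by blast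
qed

lemma M_add:
  assumes "a \<in> M k r n" "b \<in> M k r n"
  shows "a + b \<in> M k r n"
proof -
  obtain L s where s: "s \<in> S k r" "ml s \<le> L" "a = L * int n + s" using assms(1) mem_M_iff by blast
  obtain L' s' where s': "s' \<in> S k r" "ml s' \<le> L'" "b = L' * int n + s'" using assms(2) mem_M_iff by blast
  have "s + s' \<in> S k r" "ml (s + s') \<le> L + L'" "a + b = (L + L') * int n + (s + s')"
    using S_add[OF s(1) s'(1)] min_length_add[OF s(1) s'(1)] s s' by (auto simp: algebra_simps)
  then show ?thesis unfolding mem_M_iff by blast
qed

lemma multiple_n_mem_M: "0 \<le> L \<Longrightarrow> L * int n \<in> M k r n"
  unfolding mem_M_iff using zero_mem_S min_length_zero by (intro exI[of _ L] exI[of _ 0]) auto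

lemma generator_mem_M: "j \<in> {1..k} \<Longrightarrow> int n + int (r j) \<in> M k r n"
  unfolding mem_M_iff using r_mem_S min_length_le[OF has_length_r]
  by (intro exI[of _ 1] exI[of _ "int (r j)"]) auto

text \<open>
  The representation \<open>L n + i\<close> of an integer with \<open>d dvd i\<close> is unique up to moving multiples of
  \<open>d n\<close> between the two summands, since \<open>n\<close> and \<open>d\<close> are coprime.
\<close>

lemma mem_M_dvd_iff:
  assumes "D dvd i"
  shows "L * int n + i \<in> M k r n \<longleftrightarrow>
    (\<exists>q. i + q * (D * int n) \<in> S k r \<and> ml (i + q * (D * int n)) \<le> L - q * D)"
proof
  assume "L * int n + i \<in> M k r n"
  then obtain L' s where s: "s \<in> S k r" "ml s \<le> L'" "L * int n + i = L' * int n + s"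
    using mem_M_iff by blast
  have "s - i = (L - L') * int n" using s(3) by (simp add: algebra_simps)
  then have "int n dvd s - i" by simp
  moreover have "D dvd s - i" using D_dvd_S[OF s(1)] assms by (rule dvd_diff)
  ultimately have "D * int n dvd s - i"
    using coprime_n_d by (intro divides_mult) (auto simp: coprime_commute)
  then obtain q where q: "s - i = (D * int n) * q" by (auto simp: dvd_def)
  have "(L - L') * int n = (q * D) * int n" using q s(3) by (simp add: algebra_simps)
  then have "L - L' = q * D" using n_pos by simp
  moreover have "s = i + q * (D * int n)" using q by (simp add: algebra_simps)
  ultimately show "\<exists>q. i + q * (D * int n) \<in> S k r \<and> ml (i + q * (D * int n)) \<le> L - q * D"
    using s by (intro exI[of _ q]) auto
next
  assume "\<exists>q. i + q * (D * int n) \<in> S k r \<and> ml (i + q * (D * int n)) \<le> L - q * D"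
  then obtain q where q: "i + q * (D * int n) \<in> S k r" "ml (i + q * (D * int n)) \<le> L - q * D" by blast
  have "L * int n + i = (L - q * D) * int n + (i + q * (D * int n))" by (simp add: algebra_simps)
  then show "L * int n + i \<in> M k r n" unfolding mem_M_iff using q by blast
qed

lemma multiple_Dn_mem_S: "0 \<le> q \<Longrightarrow> q * (D * int n) \<in> S k r"
proof (cases "q = 0")
  case False
  assume "0 \<le> q"
  then have "D * int n \<le> q * (D * int n)" using False n_pos D_pos by simp
  then have "F_S k r < q * (D * int n)" using F_S_rk_less_Dn rk_pos by linarith
  then show ?thesis by (rule F_S_props(3)) simp
qed (simp add: zero_mem_S)

lemma Ap_D:
  assumes "i \<in> Ap"
  shows "i \<in> S k r" "i - D * int n \<notin> S k r" "0 \<le> i" "i \<le> D * int n + F_S k r" "D dvd i"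
proof -
  show S: "i \<in> S k r" and notS: "i - D * int n \<notin> S k r" using assms by (auto simp: Apery_def)
  show "0 \<le> i" "D dvd i" using S S_nonneg D_dvd_S by auto
  then have "D dvd i - D * int n" by simp
  then show "i \<le> D * int n + F_S k r" using notS F_S_props(3)[of "i - D * int n"] by force
qed

lemma Ap_coefficient_nonneg:
  assumes "i \<in> Ap" "i + q * (D * int n) \<in> S k r"
  shows "0 \<le> q"
proof (rule ccontr)
  assume "\<not> 0 \<le> q"
  then have "(i + q * (D * int n)) + (- q - 1) * (D * int n) \<in> S k r"
    by (intro S_add assms multiple_Dn_mem_S) auto
  moreover have "(i + q * (D * int n)) + (- q - 1) * (D * int n) = i - D * int n"
    by (simp add: algebra_simps)
  ultimately show False using Ap_D(2)[OF assms(1)] by simp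
qed

lemma multiple_Dn_ge: "1 \<le> q \<Longrightarrow> int n \<le> q * (D * int n)"
proof -
  assume "1 \<le> q"
  then have "1 * (D * int n) \<le> q * (D * int n)" using n_le_Dn n_pos by (intro mult_right_mono) auto
  then show ?thesis using n_le_Dn by linarith
qed

text \<open>
  Replacing the Apery element \<open>i\<close> by a larger \<open>i + q d n \<in> S\<close> does not help: the minimal
  length of \<open>i\<close> exceeds \<open>i / r k\<close> by at most \<open>r k\<close>, so it is no larger than that of
  \<open>i + q d n\<close>, which is at least \<open>(i + q d n) / r k\<close>.
\<close>

lemma mem_M_Ap_iff:
  assumes "i \<in> Ap"
  shows "L * int n + i \<in> M k r n \<longleftrightarrow> ml i \<le> L"
proof
  assume "L * int n + i \<in> M k r n"
  then obtain q where q: "i + q * (D * int n) \<in> S k r" "ml (i + q * (D * int n)) \<le> L - q * D"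
    using mem_M_dvd_iff[OF Ap_D(5)[OF assms]] by blast
  have "0 \<le> q" using Ap_coefficient_nonneg[OF assms q(1)] .
  show "ml i \<le> L"
  proof (cases "q = 0")
    case False
    have "rk * ml i \<le> i + rk\<^sup>2" using min_length_upper[OF Ap_D(1)[OF assms]] .
    also have "\<dots> \<le> i + q * (D * int n)" using rk_sq_less multiple_Dn_ge[of q] False \<open>0 \<le> q\<close> by linarith
    also have "\<dots> \<le> rk * ml (i + q * (D * int n))" using min_length_lower[OF q(1)] .
    finally have "ml i \<le> ml (i + q * (D * int n))" using rk_pos by simp
    moreover have "0 \<le> q * D" using \<open>0 \<le> q\<close> D_pos by simp
    ultimately show ?thesis using q(2) by linarith
  qed (use q in simp)
next
  assume "ml i \<le> L"
  then show "L * int n + i \<in> M k r n" unfolding mem_M_iff using Ap_D(1)[OF assms] by blast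
qed

lemma exists_Ap_representation:
  obtains L i where "i \<in> Ap" "a = L * int n + i"
proof -
  obtain u v where uv: "u * int n + v * D = 1"
    using bezout_int[of "int n" D] coprime_n_d by (metis coprime_imp_gcd_eq_1 coprime_int_iff)
  define i0 where "i0 = a * v * D"
  have a: "a = (a * u) * int n + i0"
    using arg_cong[OF uv, of "\<lambda>x. a * x"] by (simp add: i0_def algebra_simps)
  have i0: "D dvd i0" by (simp add: i0_def)
  \<comment> \<open>The descent starts at an element of \<open>S\<close> in the residue class of \<open>i0\<close> and subtracts
    \<open>d n\<close> until it would leave \<open>S\<close>.\<close>
  define Q where "Q m \<longleftrightarrow> i0 + (\<bar>i0\<bar> + 1 - int m) * (D * int n) \<notin> S k r" for m
  have "\<not> Q 0"
  proof -
    have "1 \<le> D * int n" using n_le_Dn n_pos by linarith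
    then have "\<bar>i0\<bar> * 1 \<le> \<bar>i0\<bar> * (D * int n)" by (intro mult_left_mono) auto
    then have "D * int n \<le> i0 + (\<bar>i0\<bar> + 1) * (D * int n)" by (simp add: distrib_right)
    then have "F_S k r < i0 + (\<bar>i0\<bar> + 1) * (D * int n)"
      using F_S_less_Dn rk_pos zero_le_power2[of rk] by linarith
    then show ?thesis unfolding Q_def using F_S_props(3) i0 by simp
  qed
  moreover have "Q (nat (2 * \<bar>i0\<bar> + 2))"
  proof -
    have "1 \<le> D * int n" using n_le_Dn n_pos by linarith
    then have "(\<bar>i0\<bar> + 1) * 1 \<le> (\<bar>i0\<bar> + 1) * (D * int n)" by (intro mult_left_mono) auto
    moreover have "i0 < (\<bar>i0\<bar> + 1) * 1" by simp
    ultimately have "i0 < (\<bar>i0\<bar> + 1) * (D * int n)" by (rule less_le_trans[rotated])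
    then have "i0 + (- (\<bar>i0\<bar> + 1)) * (D * int n) < 0" unfolding mult_minus_left by simp
    moreover have "\<bar>i0\<bar> + 1 - int (nat (2 * \<bar>i0\<bar> + 2)) = - (\<bar>i0\<bar> + 1)" by simp
    ultimately show ?thesis unfolding Q_def using S_nonneg by force
  qed
  ultimately obtain m where m: "\<not> Q m" "Q (Suc m)" 
    using ex_least_nat_less[of Q "nat (2 * \<bar>i0\<bar> + 2)"] by blast
  define i where "i = i0 + (\<bar>i0\<bar> + 1 - int m) * (D * int n)"
  have "i0 + (\<bar>i0\<bar> + 1 - int (Suc m)) * (D * int n) = i - D * int n" by (simp add: i_def algebra_simps)
  then have "i \<in> Ap" using m unfolding Q_def i_def[symmetric] by (simp only: Apery_def) blast
  moreover have "a = (a * u - (\<bar>i0\<bar> + 1 - int m) * D) * int n + i"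
    by (subst a) (simp add: i_def algebra_simps)
  ultimately show ?thesis by (rule that)
qed

lemma pseudo_frobenius_form:
  assumes f: "f \<in> pseudo_frobenius (M k r n)" and i: "i \<in> Ap" and "f = L * int n + i"
  shows "L = ml i - 1"
proof -
  have "L * int n + i \<notin> M k r n" using assms by (auto simp: pseudo_frobenius_def)
  moreover have "int n \<in> M k r n" using multiple_n_mem_M[of 1] by simp
  then have "f + int n \<in> M k r n" using f n_pos by (auto simp: pseudo_frobenius_def)
  then have "(L + 1) * int n + i \<in> M k r n" using assms by (simp add: algebra_simps)
  ultimately show ?thesis using mem_M_Ap_iff[OF i] by force
qed

text \<open>
  It suffices to test the generators \<open>n + r j\<close>, because every nonzero element of \<open>M\<close> is the
  sum of a generator and an element of \<open>M\<close>.
\<close>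

lemma pseudo_frobenius_iff:
  assumes i: "i \<in> Ap"
  shows "(ml i - 1) * int n + i \<in> pseudo_frobenius (M k r n)
    \<longleftrightarrow> (\<forall>j\<in>{1..k}. ml i * int n + (i + int (r j)) \<in> M k r n)"
proof
  assume f: "(ml i - 1) * int n + i \<in> pseudo_frobenius (M k r n)"
  show "\<forall>j\<in>{1..k}. ml i * int n + (i + int (r j)) \<in> M k r n"
  proof
    fix j assume j: "j \<in> {1..k}"
    have "(ml i - 1) * int n + i + (int n + int (r j)) \<in> M k r n"
      using f generator_mem_M[OF j] n_pos by (auto simp: pseudo_frobenius_def)
    then show "ml i * int n + (i + int (r j)) \<in> M k r n" by (simp add: algebra_simps)
  qed
next
  assume gens: "\<forall>j\<in>{1..k}. ml i * int n + (i + int (r j)) \<in> M k r n"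
  have "(ml i - 1) * int n + i + h \<in> M k r n" if h: "h \<in> M k r n" "h \<noteq> 0" for h
  proof -
    obtain L s where s: "s \<in> S k r" "ml s \<le> L" "h = L * int n + s" using h mem_M_iff by blast
    show ?thesis
    proof (cases "s = 0")
      case True
      then have "1 \<le> L" using s h min_length_zero by (cases "L = 0") auto
      moreover have "ml i * int n + i \<in> M k r n" using mem_M_Ap_iff[OF i] by blast
      ultimately have "(ml i * int n + i) + (L - 1) * int n \<in> M k r n"
        by (intro M_add[OF _ multiple_n_mem_M]) auto
      then show ?thesis using s True by (simp add: algebra_simps)
    next
      case False
      then obtain j s' where j: "j \<in> {1..k}" "s' \<in> S k r" "s = int (r j) + s'" "ml s' + 1 \<le> ml s"
        using S_split[OF s(1)] by blast
      have "(L - 1) * int n + s' \<in> M k r n" unfolding mem_M_iff using j s(2)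
        by (intro exI[of _ "L - 1"] exI[of _ s']) auto
      then have "(ml i * int n + (i + int (r j))) + ((L - 1) * int n + s') \<in> M k r n"
        using gens j(1) by (blast intro: M_add)
      then show ?thesis using s j by (simp add: algebra_simps)
    qed
  qed
  moreover have "(ml i - 1) * int n + i \<notin> M k r n" using mem_M_Ap_iff[OF i] by simp
  ultimately show "(ml i - 1) * int n + i \<in> pseudo_frobenius (M k r n)" by (simp add: pseudo_frobenius_def)
qed

lemma P_iff_mem_M: "i \<in> P k r n \<longleftrightarrow> i \<in> Ap \<and> (\<forall>j\<in>{1..k}. ml i * int n + (i + int (r j)) \<in> M k r n)"
proof -
  have "(\<exists>f\<in>pseudo_frobenius (M k r n). [f = i] (mod int n)) \<longleftrightarrow> (ml i - 1) * int n + i \<in> pseudo_frobenius (M k r n)"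
    if i: "i \<in> Ap"
  proof
    assume "\<exists>f\<in>pseudo_frobenius (M k r n). [f = i] (mod int n)"
    then obtain f where f: "f \<in> pseudo_frobenius (M k r n)" "[f = i] (mod int n)" by blast
    then obtain L where "f - i = int n * L" by (auto simp: cong_iff_dvd_diff dvd_def)
    then have "f = L * int n + i" by (simp add: algebra_simps)
    with pseudo_frobenius_form[OF f(1) i this] f(1)
    show "(ml i - 1) * int n + i \<in> pseudo_frobenius (M k r n)" by simp
  next
    assume "(ml i - 1) * int n + i \<in> pseudo_frobenius (M k r n)"
    then show "\<exists>f\<in>pseudo_frobenius (M k r n). [f = i] (mod int n)"
      by (rule bexI[rotated]) (simp add: cong_iff_dvd_diff)
  qed
  then show ?thesis unfolding P_def using pseudo_frobenius_iff by auto
qed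

lemma P_subset_Ap: "P k r n \<subseteq> Ap" by (auto simp: P_def)

lemma pseudo_frobenius_eq: "pseudo_frobenius (M k r n) = (\<lambda>i. g i - int n) ` P k r n"
proof -
  have "\<exists>i\<in>P k r n. f = g i - int n" if f: "f \<in> pseudo_frobenius (M k r n)" for f
  proof -
    obtain L i where i: "i \<in> Ap" "f = L * int n + i" by (rule exists_Ap_representation)
    then have L: "L = ml i - 1" using pseudo_frobenius_form f by blast
    then have "i \<in> P k r n" using i f pseudo_frobenius_iff[OF i(1)] unfolding P_iff_mem_M by simp
    then show ?thesis using i L by (intro bexI[of _ i]) (simp_all add: algebra_simps)
  qed
  moreover have "g i - int n \<in> pseudo_frobenius (M k r n)" if "i \<in> P k r n" for i
    using that pseudo_frobenius_iff[of i] unfolding P_iff_mem_M by (simp add: algebra_simps)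
  ultimately show ?thesis by blast
qed

lemma finite_Ap: "finite Ap"
  by (rule finite_subset[of _ "{0..D * int n + F_S k r}"]) (use Ap_D in auto)

lemma exists_max_Ap: obtains l where "l \<in> Ap" "\<And>i. i \<in> Ap \<Longrightarrow> g i \<le> g l"
proof -
  obtain L i where "i \<in> Ap" "0 = L * int n + i" by (rule exists_Ap_representation)
  then have ne: "g ` Ap \<noteq> {}" by blast
  have fin: "finite (g ` Ap)" using finite_Ap by simp
  obtain l where "l \<in> Ap" "g l = Max (g ` Ap)" using Max_in[OF fin ne] by auto
  then show ?thesis using that Max_ge[OF fin] by simp
qed

text \<open>
  In the residue class of \<open>i \<in> Ap\<close> modulo \<open>n\<close>, the largest gap of \<open>M\<close> is
  \<open>g i - n\<close>. So the maximum of \<open>g\<close> on the Apery set yields the Frobenius number.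
\<close>

lemma above_max_mem_M:
  assumes l: "l \<in> Ap" "\<And>i. i \<in> Ap \<Longrightarrow> g i \<le> g l" and "g l - int n < z"
  shows "z \<in> M k r n"
proof -
  obtain L i where i: "i \<in> Ap" "z = L * int n + i" by (rule exists_Ap_representation)
  have "ml i \<le> L"
  proof (rule ccontr)
    assume "\<not> ml i \<le> L"
    then have "L * int n \<le> (ml i - 1) * int n" by (intro mult_right_mono) auto
    then show False using i assms(3) l(2)[OF i(1)] by (simp add: algebra_simps)
  qed
  then show ?thesis using mem_M_Ap_iff[OF i(1)] i by simp
qed

lemma numerical_semigroup_M:
  assumes l: "l \<in> Ap" "\<And>i. i \<in> Ap \<Longrightarrow> g i \<le> g l"
  shows "numerical_semigroup (M k r n) (g l - int n) (int n)"
proof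
  show "0 \<in> M k r n" using multiple_n_mem_M[of 0] by simp
  show "a + b \<in> M k r n" if "a \<in> M k r n" "b \<in> M k r n" for a b using that by (rule M_add)
  show "0 \<le> a" if a: "a \<in> M k r n" for a
  proof -
    obtain L s where s: "s \<in> S k r" "ml s \<le> L" "a = L * int n + s" using a mem_M_iff by blast
    then show ?thesis using S_nonneg n_pos by simp
  qed
  show "g l - int n \<notin> M k r n" using mem_M_Ap_iff[OF l(1), of "ml l - 1"] by (simp add: algebra_simps)
  show "z \<in> M k r n" if "g l - int n < z" for z using above_max_mem_M[OF l that] .
  show "int n \<in> M k r n" using multiple_n_mem_M[of 1] by simp
  show "0 < int n" by (rule n_pos)
  show "int n \<le> a" if a: "a \<in> M k r n" "a \<noteq> 0" for a
  proof -
    obtain L s where s: "s \<in> S k r" "ml s \<le> L" "a = L * int n + s" using a mem_M_iff by blast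
    have "0 \<le> s" using S_nonneg[OF s(1)] .
    have "L \<noteq> 0"
    proof
      assume "L = 0"
      then have "ml s = 0" using s(2) by simp
      then have "s = 0" using min_length_lower[OF s(1)] \<open>0 \<le> s\<close> by simp
      then show False using a s \<open>L = 0\<close> by simp
    qed
    then have "1 * int n \<le> L * int n" using s(2) by (intro mult_right_mono) auto
    then show ?thesis using s \<open>0 \<le> s\<close> by simp
  qed
qed

lemma canonical_reduction_iff:
  assumes l: "l \<in> Ap" "\<And>i. i \<in> Ap \<Longrightarrow> g i \<le> g l"
  shows "has_canonical_reduction TYPE('k::field) (M k r n)
    \<longleftrightarrow> (\<forall>i\<in>P k r n. (1 + ml l - ml i) * int n + (l - i) \<in> M k r n)"
proof -
  interpret numerical_semigroup "M k r n" "g l - int n" "int n" by (rule numerical_semigroup_M[OF l])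
  have eq: "int n + (g l - int n) - (g i - int n) = (1 + ml l - ml i) * int n + (l - i)" for i
    by (simp add: algebra_simps)
  show ?thesis unfolding has_canonical_reduction_iff pseudo_frobenius_eq by (simp only: ball_simps eq)
qed

lemma max_mem_P:
  assumes l: "l \<in> Ap" "\<And>i. i \<in> Ap \<Longrightarrow> g i \<le> g l"
  shows "l \<in> P k r n"
  unfolding P_iff_mem_M using l n_pos by (auto intro!: above_max_mem_M[OF l])

text \<open>
  Either \<open>i + r j\<close> itself is no longer than \<open>i\<close>, or it leaves the Apery set. In the latter
  case \<open>i + r j - d n\<close> is so small, and \<open>i\<close> so large, that the length of the former is
  automatically at most the length of \<open>i\<close> plus \<open>d\<close>, which is the bound for a shift by
  \<open>d n\<close>.
\<close>

lemma P_iff: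
  "i \<in> P k r n \<longleftrightarrow> i \<in> Ap \<and> (\<forall>j\<in>{1..k}. ml (i + int (r j)) \<le> ml i \<or> i + int (r j) - D * int n \<in> S k r)"
proof -
  have "ml i * int n + (i + int (r j)) \<in> M k r n \<longleftrightarrow>
      ml (i + int (r j)) \<le> ml i \<or> i + int (r j) - D * int n \<in> S k r" (is "?l \<longleftrightarrow> ?r")
    if i: "i \<in> Ap" and j: "j \<in> {1..k}" for j
  proof -
    have rj: "0 < int (r j)" "int (r j) \<le> rk" using r_pos[OF j] r_le[OF j] by auto
    have S: "i + int (r j) \<in> S k r" using S_add[OF Ap_D(1)[OF i] r_mem_S[OF j]] .
    have dvd: "D dvd i + int (r j)" using D_dvd_S[OF S] .
    show ?thesis
    proof
      assume ?l
      then obtain q where q: "i + int (r j) + q * (D * int n) \<in> S k r"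
        "ml (i + int (r j) + q * (D * int n)) \<le> ml i - q * D"
        using mem_M_dvd_iff[OF dvd] by blast
      have "q \<le> 0"
      proof (rule ccontr)
        assume "\<not> q \<le> 0"
        then have "1 \<le> q" by simp
        have "i + int (r j) + q * (D * int n) \<le> rk * ml (i + int (r j) + q * (D * int n))"
          using min_length_lower[OF q(1)] .
        also have "\<dots> \<le> rk * ml i"
        proof (intro mult_left_mono)
          have "0 \<le> q * D" using \<open>1 \<le> q\<close> D_pos by simp
          then show "ml (i + int (r j) + q * (D * int n)) \<le> ml i" using q(2) by linarith
        qed simp
        also have "\<dots> \<le> i + rk\<^sup>2" using min_length_upper[OF Ap_D(1)[OF i]] .
        finally show False using multiple_Dn_ge[OF \<open>1 \<le> q\<close>] rk_sq_less rj by linarith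
      qed
      moreover have "-1 \<le> q"
      proof (rule ccontr)
        assume "\<not> -1 \<le> q"
        then have "q * (D * int n) \<le> (-2) * (D * int n)" using n_le_Dn n_pos by (intro mult_right_mono) auto
        then show False using S_nonneg[OF q(1)] Ap_D(4)[OF i] F_S_less_Dn rj zero_le_power2[of rk] by linarith
      qed
      ultimately consider "q = 0" | "q = -1" by linarith
      then show ?r using q by cases auto
    next
      assume ?r
      then show ?l
      proof
        assume "ml (i + int (r j)) \<le> ml i"
        then show ?l unfolding mem_M_iff using S by blast
      next
        assume s: "i + int (r j) - D * int n \<in> S k r"
        have "rk * ml (i + int (r j) - D * int n) \<le> i + int (r j) - D * int n + rk\<^sup>2"
          using min_length_upper[OF s] .
        also have "\<dots> \<le> F_S k r + rk + rk\<^sup>2" using Ap_D(4)[OF i] rj by simp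
        also have "\<dots> < D * int n" by (rule F_S_less_Dn)
        also have "\<dots> \<le> i + rk" using S_nonneg[OF s] rj by linarith
        also have "\<dots> \<le> rk * ml i + rk * D"
          using min_length_lower[OF Ap_D(1)[OF i]] D_pos rk_pos by (intro add_mono) auto
        finally have "rk * ml (i + int (r j) - D * int n) < rk * (ml i + D)" by (simp add: distrib_left)
        then have "ml (i + int (r j) - D * int n) \<le> ml i + D" using rk_pos by simp
        then show ?l unfolding mem_M_dvd_iff[OF dvd] using s by (intro exI[of _ "-1"]) simp
      qed
    qed
  qed
  then show ?thesis unfolding P_iff_mem_M by blast
qed

text \<open>
  This makes \<open>P'\<close> visibly independent of \<open>n\<close>. The bound on \<open>i\<close> comes from the
  generator \<open>r k\<close>: for larger \<open>i\<close>, adding \<open>r k\<close> would increase the length.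
\<close>

lemma P'_iff:
  "i \<in> P' k r n \<longleftrightarrow> i \<in> S k r \<and> i + rk \<le> rk\<^sup>2 \<and> (\<forall>j\<in>{1..k}. ml (i + int (r j)) \<le> ml i)"
proof
  assume "i \<in> P' k r n"
  then have i: "i \<in> P k r n" "i + rk < D * int n" by (auto simp: P'_def)
  then have Ap: "i \<in> Ap" using P_subset_Ap by blast
  have ml: "ml (i + int (r j)) \<le> ml i" if "j \<in> {1..k}" for j
  proof -
    have "i + int (r j) - D * int n < 0" using i(2) r_le[OF that] by linarith
    then show ?thesis using i(1) that S_nonneg unfolding P_iff by force
  qed
  moreover have "i + rk \<le> rk\<^sup>2"
    using ml[of k] k_pos min_length_large(2)[OF S_add[OF Ap_D(1)[OF Ap] rk_mem_S]] by force
  ultimately show "i \<in> S k r \<and> i + rk \<le> rk\<^sup>2 \<and> (\<forall>j\<in>{1..k}. ml (i + int (r j)) \<le> ml i)"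
    using Ap_D(1)[OF Ap] by blast
next
  assume i: "i \<in> S k r \<and> i + rk \<le> rk\<^sup>2 \<and> (\<forall>j\<in>{1..k}. ml (i + int (r j)) \<le> ml i)"
  then have lt: "i + rk < D * int n" using rk_sq_less n_le_Dn by linarith
  then have "i - D * int n < 0" using rk_pos by linarith
  then have "i \<in> Ap" using i S_nonneg unfolding Apery_def by force
  then show "i \<in> P' k r n" using i lt unfolding P'_def P_iff by auto
qed

lemma P''_D:
  assumes "i \<in> P'' k r n"
  shows "i \<in> Ap" "i \<in> S k r" "D * int n - rk \<le> i" "i \<le> D * int n + F_S k r" "rk\<^sup>2 < i + rk" "D dvd i"
proof -
  show Ap: "i \<in> Ap" using assms P_subset_Ap by (auto simp: P''_def)
  show "D * int n - rk \<le> i" using assms by (simp add: P''_def)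
  then show "rk\<^sup>2 < i + rk" using rk_sq_less n_le_Dn by linarith
  show "i \<in> S k r" "i \<le> D * int n + F_S k r" "D dvd i" using Ap_D[OF Ap] by auto
qed

text \<open>
  The index of the Frobenius number is large: \<open>d n - d\<close> is an Apery element whose length is at
  least \<open>d n / r k - 1\<close>, and the hypothesis says that indices in \<open>P'\<close> have smaller length, so
  none of them maximizes \<open>g\<close>.
\<close>

lemma max_mem_P'':
  assumes l: "l \<in> Ap" "\<And>i. i \<in> Ap \<Longrightarrow> g i \<le> g l"
    and N3: "\<And>l. l \<in> P' k r n \<Longrightarrow> ml l * rk + 3 * rk < D * int n"
  shows "l \<in> P'' k r n"
proof (rule ccontr)
  assume "l \<notin> P'' k r n"
  then have P': "l \<in> P' k r n" using max_mem_P[OF l] by (auto simp: P'_def P''_def)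
  define i where "i = D * int n - D"
  have "F_S k r < i"
  proof -
    have "1 * (int n - 1) \<le> D * (int n - 1)" using D_pos n_pos by (intro mult_right_mono) auto
    then have "int n - 1 \<le> i" by (simp add: i_def right_diff_distrib)
    then show ?thesis using n_large rk_pos zero_le_power2[of rk] by linarith
  qed
  then have S: "i \<in> S k r" by (intro F_S_props(3)) (auto simp: i_def)
  moreover have "- D \<notin> S k r" using S_nonneg[of "- D"] D_pos by auto
  ultimately have "i \<in> Ap" by (simp add: Apery_def i_def)
  then have "g i \<le> g l" by (rule l(2))
  moreover have "l < i" using P' D_le_rk by (auto simp: P'_def i_def)
  ultimately have "ml i * int n < ml l * int n" by linarith
  then have "ml i < ml l" using n_pos by simp
  then have "rk * ml i \<le> rk * ml l" by (intro mult_left_mono) auto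
  moreover have "D * int n - D \<le> rk * ml i" using min_length_lower[OF S] by (simp add: i_def)
  moreover have "ml l * rk + 3 * rk < D * int n" by (rule N3[OF P'])
  ultimately show False using D_le_rk rk_pos mult.commute[of rk "ml l"] by linarith
qed

section \<open>Shifting by multiples of the largest generator\<close>

text \<open>
  The condition for the pair \<open>(i, l)\<close> is witnessed by an integer \<open>q\<close> with
  \<open>l - i + q d n \<in> S\<close>. A positive \<open>q\<close> could be destroyed by the shift, but it is excluded by
  the bounds: for \<open>i \<in> P''\<close> by the first hypothesis, for \<open>i \<in> P'\<close> by the size of
  \<open>n\<close> alone. For \<open>q \<le> 0\<close> the same \<open>q\<close> is a witness for the shifted indices.
\<close>

theorem canonical_reduction_shift:
  fixes t :: nat
  assumes N2: "\<And>i l. i \<in> P'' k r n \<Longrightarrow> l \<in> P'' k r n \<Longrightarrow> (ml l - ml i) * rk - l + i < int n"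
    and N3: "\<And>l. l \<in> P' k r n \<Longrightarrow> ml l * rk + 3 * rk < D * int n"
    and red: "has_canonical_reduction TYPE('k::field) (M k r n)"
  shows "has_canonical_reduction TYPE('k) (M k r (n + t * r k))"
proof -
  define n' where "n' = n + t * r k"
  have n': "int n' = int n + int t * rk" by (simp add: n'_def)
  have n_le: "int n \<le> int n'" by (simp add: n'_def)
  interpret n': shifted_semigroup k r n'
  proof
    have "d k r dvd t * r k" using D_dvd_rk by simp
    then show "coprime n' (d k r)" using coprime_n_d unfolding n'_def
      by (metis coprime_iff_gcd_eq_1 dvdE gcd.commute gcd_add_mult mult.commute add.commute)
    show "F_S k r + rk + rk\<^sup>2 < int n'" using n_large n_le by linarith
  qed
  define c where "c = int (t * d k r) * rk"
  have Dn': "D * int n' = D * int n + c" by (simp add: n' c_def algebra_simps)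
  have c_nonneg: "0 \<le> c" by (simp add: c_def)
  have ml_shift: "ml (i + c) = ml i + int t * D" if "i \<in> S k r" "rk\<^sup>2 < i + rk" for i
    unfolding c_def using min_length_add_multiple_rk_large[OF that, of "t * d k r"] by simp
  have ml_shift_le: "ml (i + c) \<le> ml i + int t * D" if "i \<in> S k r" for i
    unfolding c_def using min_length_add_multiple_rk[OF that, of "t * d k r"] by simp
  have S_shift: "i + c \<in> S k r" if "i \<in> S k r" for i
    unfolding c_def by (rule S_add_multiple_rk[OF that])
  have P'_eq: "P' k r n' = P' k r n" using P'_iff n'.P'_iff by blast
  have P''_iff: "i + c \<in> P'' k r n' \<longleftrightarrow> i \<in> P'' k r n" for i
  proof (cases "D * int n - rk \<le> i \<and> D dvd i")
    case True
    then have ge: "D * int n - rk \<le> i" and dvd: "D dvd i" by auto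
    have S: "i \<in> S k r"
      using ge F_S_rk_less_Dn dvd by (intro F_S_props(3)) auto
    have large: "rk\<^sup>2 < i + rk" using ge rk_sq_less n_le_Dn by linarith
    have Ap: "i + c \<in> n'.Ap \<longleftrightarrow> i \<in> Ap" using S S_shift by (simp add: Apery_def Dn')
    have "ml (i + c + int (r j)) \<le> ml (i + c) \<or> i + c + int (r j) - D * int n' \<in> S k r
        \<longleftrightarrow> ml (i + int (r j)) \<le> ml i \<or> i + int (r j) - D * int n \<in> S k r" if j: "j \<in> {1..k}" for j
    proof -
      have "rk\<^sup>2 < i + int (r j) + rk" using large by linarith
      then have "ml (i + int (r j) + c) = ml (i + int (r j)) + int t * D"
        by (rule ml_shift[OF S_add[OF S r_mem_S[OF j]]])
      moreover have eq: "i + c + int (r j) = i + int (r j) + c" "i + int (r j) + c - D * int n' = i + int (r j) - D * int n"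
        by (simp_all add: Dn')
      ultimately show ?thesis using ml_shift[OF S large] unfolding eq by simp
    qed
    then have "i + c \<in> P k r n' \<longleftrightarrow> i \<in> P k r n" unfolding P_iff n'.P_iff Ap by blast
    then show ?thesis by (simp add: P''_def Dn')
  next
    case False
    have "D dvd c" unfolding c_def by simp
    then have "i + c \<notin> P'' k r n'" using False n'.P''_D(3,6)[of "i + c"] by (auto simp: Dn' dvd_add_left_iff)
    moreover have "i \<notin> P'' k r n" using False P''_D(3,6)[of i] by auto
    ultimately show ?thesis by simp
  qed
  obtain l' where l': "l' \<in> n'.Ap" "\<And>i. i \<in> n'.Ap \<Longrightarrow> n'.g i \<le> n'.g l'"
    using n'.exists_max_Ap by blast
  have "l' \<in> P'' k r n'"
  proof (rule n'.max_mem_P''[OF l'])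
    fix l assume "l \<in> P' k r n'"
    then have "ml l * rk + 3 * rk < D * int n" using N3 P'_eq by blast
    then show "ml l * rk + 3 * rk < D * int n'" using Dn' c_nonneg by linarith
  qed
  define l where "l = l' - c"
  have l'_eq: "l' = l + c" by (simp add: l_def)
  have lP: "l \<in> P'' k r n" using \<open>l' \<in> P'' k r n'\<close> P''_iff unfolding l'_eq by blast
  note l = P''_D[OF lP]
  have ml_l': "ml l' = ml l + int t * D" unfolding l'_eq by (rule ml_shift[OF l(2,5)])
  have dist: "\<bar>x - y\<bar> < int n" if "x \<in> P'' k r n" "y \<in> P'' k r n" for x y
    using P''_D(3,4)[OF that(1)] P''_D(3,4)[OF that(2)] n_large zero_le_power2[of rk] by linarith
  \<comment> \<open>Indices in \<open>P''\<close> differ by less than \<open>n\<close>, so \<open>g\<close> orders them first by length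
    and then by size. This order is preserved by the shift.\<close>
  have lmax: "g i \<le> g l" if "i \<in> Ap" for i
  proof -
    obtain l0 where l0: "l0 \<in> Ap" "\<And>i. i \<in> Ap \<Longrightarrow> g i \<le> g l0" using exists_max_Ap by blast
    have l0P: "l0 \<in> P'' k r n" by (rule max_mem_P''[OF l0 N3])
    have "n'.g (l0 + c) \<le> n'.g l'" using P''_iff l0P n'.P''_D(1) by (intro l'(2)) blast
    then have 1: "ml l0 * int n' + l0 \<le> ml l * int n' + l"
      using ml_shift[OF P''_D(2,5)[OF l0P]] ml_l' l'_eq by (simp add: algebra_simps)
    have 2: "ml l * int n + l \<le> ml l0 * int n + l0" using l0(2)[OF l(1)] .
    have "ml l0 \<le> ml l"
    proof (rule ccontr)
      assume "\<not> ml l0 \<le> ml l"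
      then have "(ml l + 1) * int n' \<le> ml l0 * int n'" by (intro mult_right_mono) auto
      then show False using 1 dist[OF l0P lP] n_le by (simp add: distrib_right)
    qed
    moreover have "ml l \<le> ml l0"
    proof (rule ccontr)
      assume "\<not> ml l \<le> ml l0"
      then have "(ml l0 + 1) * int n \<le> ml l * int n" by (intro mult_right_mono) auto
      then show False using 2 dist[OF lP l0P] by (simp add: distrib_right)
    qed
    ultimately have "l0 = l" using 1 2 by auto
    then show ?thesis using l0(2)[OF that] by simp
  qed
  have C: "(1 + ml l - ml i) * int n + (l - i) \<in> M k r n" if "i \<in> P k r n" for i
    using canonical_reduction_iff[OF l(1) lmax] red that by blast
  have "(1 + ml l' - ml i') * int n' + (l' - i') \<in> M k r n'" if i': "i' \<in> P k r n'" for i'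
  proof -
    consider "i' \<in> P' k r n'" | "i' \<in> P'' k r n'" using i' unfolding P'_def P''_def by force
    then show ?thesis
    proof cases
      case 1
      then have i: "i' \<in> P' k r n" using P'_eq by simp
      then have iS: "i' \<in> S k r" and iP: "i' \<in> P k r n" using P'_iff by (auto simp: P'_def)
      have dvd: "D dvd l - i'" "D dvd l' - i'"
        using l(6) D_dvd_S[OF iS] D_dvd_S[OF n'.Ap_D(1)[OF l'(1)]] by (auto intro: dvd_diff)
      obtain q where q: "l - i' + q * (D * int n) \<in> S k r"
        "ml (l - i' + q * (D * int n)) \<le> 1 + ml l - ml i' - q * D"
        using C[OF iP] unfolding mem_M_dvd_iff[OF dvd(1)] by blast
      have "q \<le> 0"
      proof (rule ccontr)
        assume "\<not> q \<le> 0"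
        then have "1 \<le> q" by simp
        then have "1 * 1 \<le> q * D" using D_pos by (intro mult_mono) auto
        then have "ml (l - i' + q * (D * int n)) \<le> ml l - ml i'" using q(2) by linarith
        then have "rk * ml (l - i' + q * (D * int n)) \<le> rk * (ml l - ml i')" by (intro mult_left_mono) auto
        then have "l - i' + q * (D * int n) \<le> rk * ml l - rk * ml i'"
          using min_length_lower[OF q(1)] by (simp add: right_diff_distrib)
        then show False
          using min_length_upper[OF l(2)] min_length_lower[OF iS] multiple_Dn_ge[OF \<open>1 \<le> q\<close>] rk_sq_less
          by linarith
      qed
      moreover have "-1 \<le> q"
      proof (rule ccontr)
        assume "\<not> -1 \<le> q"
        then have "q * (D * int n) \<le> (-2) * (D * int n)" using n_le_Dn n_pos by (intro mult_right_mono) auto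
        then show False
          using S_nonneg[OF q(1)] S_nonneg[OF iS] l(4) F_S_less_Dn rk_pos zero_le_power2[of rk] by linarith
      qed
      ultimately consider "q = 0" | "q = -1" by linarith
      then show ?thesis
      proof cases
        case 1
        \<comment> \<open>Here \<open>s = l - i'\<close> moves by \<open>c\<close>, and its length grows at most by the amount
          by which the length of \<open>l\<close> grows.\<close>
        have eq: "l' - i' = (l - i') + c" by (simp add: l'_eq)
        have s: "l - i' \<in> S k r" "ml (l - i') \<le> 1 + ml l - ml i'" using q unfolding 1 by auto
        have "l' - i' \<in> S k r" unfolding eq by (rule S_shift[OF s(1)])
        moreover have "ml (l' - i') \<le> 1 + ml l' - ml i'"
          unfolding eq using ml_shift_le[OF s(1)] s(2) ml_l' by linarith
        ultimately show ?thesis unfolding n'.mem_M_iff by blast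
      next
        case 2
        \<comment> \<open>Here \<open>s = l - i' - d n\<close> is unchanged by the shift, while its bound increases.\<close>
        have eq: "l' - i' + (-1) * (D * int n') = l - i' + (-1) * (D * int n)" by (simp add: l'_eq Dn')
        have "0 \<le> int t * D" by simp
        then have "ml (l' - i' + (-1) * (D * int n')) \<le> 1 + ml l' - ml i' - (-1) * D"
          unfolding eq using q(2) ml_l' unfolding 2 by linarith
        moreover have "l' - i' + (-1) * (D * int n') \<in> S k r" unfolding eq using q(1) unfolding 2 .
        ultimately show ?thesis unfolding n'.mem_M_dvd_iff[OF dvd(2)] by blast
      qed
    next
      case 2
      define i where "i = i' - c"
      have i'_eq: "i' = i + c" by (simp add: i_def)
      have iP: "i \<in> P'' k r n" using 2 P''_iff unfolding i'_eq by blast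
      note i = P''_D[OF iP]
      have ml_i': "ml i' = ml i + int t * D" unfolding i'_eq by (rule ml_shift[OF i(2,5)])
      have dvd: "D dvd l - i" using l(6) i(6) by (rule dvd_diff)
      have iPn: "i \<in> P k r n" using iP by (simp add: P''_def)
      obtain q where q: "l - i + q * (D * int n) \<in> S k r"
        "ml (l - i + q * (D * int n)) \<le> 1 + ml l - ml i - q * D"
        using C[OF iPn] unfolding mem_M_dvd_iff[OF dvd] by blast
      have "q \<le> 0"
      proof (rule ccontr)
        assume "\<not> q \<le> 0"
        then have "1 \<le> q" by simp
        then have "1 * 1 \<le> q * D" using D_pos by (intro mult_mono) auto
        then have "ml (l - i + q * (D * int n)) \<le> ml l - ml i" using q(2) by linarith
        then have "rk * ml (l - i + q * (D * int n)) \<le> rk * (ml l - ml i)" by (intro mult_left_mono) auto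
        then have "l - i + q * (D * int n) \<le> (ml l - ml i) * rk"
          using min_length_lower[OF q(1)] by (simp add: mult.commute)
        then show False using N2[OF iP lP] multiple_Dn_ge[OF \<open>1 \<le> q\<close>] by linarith
      qed
      moreover have "0 \<le> q"
      proof (rule ccontr)
        assume "\<not> 0 \<le> q"
        then have "int n \<le> (- q) * (D * int n)" by (intro multiple_Dn_ge) simp
        then show False using S_nonneg[OF q(1)] dist[OF lP iP] by simp
      qed
      ultimately have "q = 0" by simp
      then have "l' - i' \<in> S k r" "ml (l' - i') \<le> 1 + ml l' - ml i'"
        using q ml_l' ml_i' by (auto simp: l'_eq i'_eq)
      then show ?thesis unfolding n'.mem_M_iff by blast
    qed
  qed
  then show ?thesis
    using n'.canonical_reduction_iff[OF l', where 'k = 'k] unfolding n'_def by blast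
qed

end

theorem corollary6p1:
  fixes k n :: nat and r :: "nat \<Rightarrow> nat"
  assumes "k \<ge> 2"
    and "r 0 = 0"
    and "strict_mono_on {0..k} r"
    and "n > 0"
    and "coprime n (d k r)"
    and "int n > N0 k r"
    and "int n > N_bound k r n"
    and "has_canonical_reduction TYPE('k::field) (M k r n)"
  shows "\<forall>m::nat. has_canonical_reduction TYPE('k) (M k r (n + m * r k))"
proof -
  interpret shifted_family k r using assms by unfold_locales auto
  have bounds: "N0 k r + rk + F_S k r div D < int n" "N2 k r n < int n" "N3 k r n < int n"
    using assms(7) unfolding N_bound_def by auto
  \<comment> \<open>For \<open>F_S \<ge> 0\<close> the term \<open>F_S * r k\<close> in \<open>N0\<close> dominates \<open>F_S\<close>;
    otherwise \<open>F_S div d \<ge> -1\<close>, which costs no more than \<open>F_S < 0\<close> gains.\<close>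
  have large: "F_S k r + rk + rk\<^sup>2 < int n"
  proof (cases "0 \<le> F_S k r")
    case True
    then have "F_S k r * 1 \<le> F_S k r * rk" using rk_pos by (intro mult_left_mono) auto
    moreover have "0 \<le> F_S k r div D" using True D_pos by (simp add: pos_imp_zdiv_nonneg_iff)
    moreover have "rk\<^sup>2 + F_S k r * rk \<le> N0 k r" unfolding N0_def by simp
    ultimately show ?thesis using bounds(1) by linarith
  next
    case False
    have "((-1) * D) div D \<le> F_S k r div D" using F_S_props(2) D_pos by (intro zdiv_mono1) auto
    moreover have "((-1) * D) div D = -1" using D_pos by (intro nonzero_mult_div_cancel_right) simp
    ultimately have "-1 \<le> F_S k r div D" by simp
    moreover have "rk\<^sup>2 \<le> N0 k r" unfolding N0_def by simp
    ultimately show ?thesis using bounds(1) False by linarith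
  qed
  interpret shifted_semigroup k r n using assms(5) large by unfold_locales
  have fin: "finite (P k r n)" using finite_subset[OF P_subset_Ap finite_Ap] .
  have "(ml l - ml i) * rk - l + i < int n" if "i \<in> P'' k r n" "l \<in> P'' k r n" for i l
  proof -
    let ?A = "{(ml l - ml i) * rk - l + i | i l. i \<in> P'' k r n \<and> l \<in> P'' k r n}"
    have "finite (P'' k r n)" using fin by (simp add: P''_def)
    then have "finite ((\<lambda>(i, l). (ml l - ml i) * rk - l + i) ` (P'' k r n \<times> P'' k r n))" by simp
    then have "finite ?A" by (rule rev_finite_subset) auto
    then have "(ml l - ml i) * rk - l + i \<le> N2 k r n"
      unfolding N2_def using that by (intro Max_ge) auto
    then show ?thesis using bounds(2) by linarith
  qed
  moreover have "ml l * rk + 3 * rk < D * int n" if "l \<in> P' k r n" for l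
  proof -
    let ?A = "{(ml l * rk + 3 * rk) div D | l. l \<in> P' k r n}"
    have "finite (P' k r n)" using fin by (simp add: P'_def)
    then have "finite ?A" by simp
    then have "(ml l * rk + 3 * rk) div D \<le> N3 k r n"
      unfolding N3_def using that by (intro Max_ge) auto
    then have lt: "(ml l * rk + 3 * rk) div D < int n" using bounds(3) by linarith
    show ?thesis
    proof (rule ccontr)
      assume "\<not> ?thesis"
      then have "(D * int n) div D \<le> (ml l * rk + 3 * rk) div D" using D_pos by (intro zdiv_mono1) auto
      moreover have "(D * int n) div D = int n" using D_pos by (intro nonzero_mult_div_cancel_left) simp
      ultimately show False using lt by linarith
    qed
  qed
  ultimately show ?thesis using canonical_reduction_shift assms(8) by blast
qed

end
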